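(* Let $p$ be a prime number. (1) The group $\mathrm{Aut}\,\mathcal{A}_p(+)$ consists exactly of the functions $f:\mathbb{Z}_p\to\mathbb{Z}_p$ of the form $f(x)=Ax$, where $A\in\mathbb{Z}_p$ and $A\not\equiv 0\pmod p$. (2) The group $\mathrm{Aut}\,\mathcal{A}_p(\cdot)$ consists exactly of the functions $f:\mathbb{Z}_p\to\mathbb{Z}_p$ of the form $$f(x)=\begin{cases} p^kA^k\theta^s(1+pt)^a, & \text{if } x=p^k\theta(1+pt),\\ 0, & \text{if } x=0,\end{cases}$$ where $k\ge 0$ is an integer, $t\in\mathbb{Z}_p$, $\theta\in\mathbb{Z}_p$ with $\theta^{p-1}=1$ (these being determined by the nonzero argument $x$), and where the parameters $a,A\in\mathbb{Z}_p$, $s\in\{1,\ldots,p-1\}$ of $f$ satisfy $A\not\equiv 0\pmod p$, $a\not\equiv 0\pmod p$ and $\gcd(s,p-1)=1$.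
   Context: $\mathbb{Z}_p$ is the set of $p$-adic integers, with its usual addition $+$ and multiplication $\cdot$. For a binary operation $*$ on $\mathbb{Z}_p$, $\mathcal{A}_p( * )$ denotes the algebraic system with carrier $\mathbb{Z}_p$, the single operation $*$, and the family of congruence relations modulo $p^k$ for all $k\ge 1$. An automorphism of $\mathcal{A}_p( * )$ is a bijective map $f:\mathbb{Z}_p\to\mathbb{Z}_p$ such that $f(x*y)=f(x)*f(y)$ for all $x,y\in\mathbb{Z}_p$, and such that for every $k\ge 1$ and all $x,y\in\mathbb{Z}_p$, $x\equiv y\pmod{p^k}$ implies $f(x)\equiv f(y)\pmod{p^k}$. $\mathrm{Aut}\,\mathcal{A}_p( * )$ is the group of all automorphisms of $\mathcal{A}_p( * )$ under composition. Every nonzero $x\in\mathbb{Z}_p$ is written in its Teichm\"uller representation $x=p^k\theta(1+pt)$ with $k\ge 0$ an integer, $\theta\in\mathbb{Z}_p$, $\theta^{p-1}=1$, $t\in\mathbb{Z}_p$ (for $p=2$, $\theta=1$). For $a\in\mathbb{Z}_p$, $(1+pt)^a$ is the usual $p$-adic power, i.e. the limit of $(1+pt)^{a_n}$ for any sequence of nonnegative integers $a_n$ converging $p$-adically to $a$. *)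

theory Defs
  imports "HOL-Algebra.Group" "Berlekamp_Zassenhaus.Finite_Field"
begin

section \<open>The ring of \<open>p\<close>-adic integers\<close>

text \<open>
  The prime \<open>p\<close> is the cardinality of the index type \<open>'p\<close>.  A \<open>p\<close>-adic integer is an element
  of the inverse limit of the rings \<open>\<int>/p\<^sup>n\<int>\<close>: the \<open>n\<close>-th entry of the sequence is the
  representative in \<open>{0..<p\<^sup>n}\<close> of its residue modulo \<open>p\<^sup>n\<close>.
\<close>

typedef ('p::prime_card) padic_int =
  "{x :: nat \<Rightarrow> int. \<forall>n. x n \<in> {0..<int CARD('p) ^ n} \<and> x (Suc n) mod int CARD('p) ^ n = x n}"
  morphisms residue Abs_padic_int
  by (rule exI[of _ "\<lambda>_. 0"]) simp

setup_lifting type_definition_padic_int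

lemma mod_power_Suc_mod: "(a mod (q::int) ^ Suc n) mod q ^ n = a mod q ^ n"
  by (rule mod_mod_cancel) (simp add: le_imp_power_dvd)

lemma padic_lift_mod:
  assumes "\<And>n. f (Suc n) mod int CARD('p::prime_card) ^ n = f n mod int CARD('p) ^ n"
  shows "f n mod int CARD('p) ^ n \<in> {0..<int CARD('p) ^ n} \<and>
    (f (Suc n) mod int CARD('p) ^ Suc n) mod int CARD('p) ^ n = f n mod int CARD('p) ^ n"
  unfolding mod_power_Suc_mod using assms by simp

instantiation padic_int :: (prime_card) comm_ring_1
begin

lift_definition zero_padic_int :: "'a padic_int" is "\<lambda>_. 0"
  by simp

lift_definition one_padic_int :: "'a padic_int" is "\<lambda>n. 1 mod int CARD('a) ^ n"
  by (rule padic_lift_mod) simp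

lift_definition plus_padic_int :: "'a padic_int \<Rightarrow> 'a padic_int \<Rightarrow> 'a padic_int"
  is "\<lambda>x y n. (x n + y n) mod int CARD('a) ^ n"
  by (rule padic_lift_mod) (metis mod_add_eq mod_mod_trivial)

lift_definition times_padic_int :: "'a padic_int \<Rightarrow> 'a padic_int \<Rightarrow> 'a padic_int"
  is "\<lambda>x y n. (x n * y n) mod int CARD('a) ^ n"
  by (rule padic_lift_mod) (metis mod_mult_eq mod_mod_trivial)

lift_definition uminus_padic_int :: "'a padic_int \<Rightarrow> 'a padic_int"
  is "\<lambda>x n. (- x n) mod int CARD('a) ^ n"
  by (rule padic_lift_mod) (metis mod_minus_eq mod_mod_trivial)

lift_definition minus_padic_int :: "'a padic_int \<Rightarrow> 'a padic_int \<Rightarrow> 'a padic_int"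
  is "\<lambda>x y n. (x n - y n) mod int CARD('a) ^ n"
  by (rule padic_lift_mod) (metis mod_diff_eq mod_mod_trivial)

instance
proof
  fix a b c :: "'a padic_int"
  show "a * b * c = a * (b * c)"
    by transfer (simp add: fun_eq_iff mod_mult_left_eq mod_mult_right_eq mult.assoc)
  show "a * b = b * a"
    by transfer (simp add: mult.commute)
  show "1 * a = a"
    by transfer (auto simp add: fun_eq_iff mod_mult_left_eq)
  show "a + b + c = a + (b + c)"
    by transfer (simp add: fun_eq_iff mod_add_left_eq mod_add_right_eq add.assoc)
  show "a + b = b + a"
    by transfer (simp add: add.commute)
  show "0 + a = a"
    by transfer (auto simp add: fun_eq_iff)
  show "- a + a = 0"
    by transfer (simp add: fun_eq_iff mod_add_left_eq)
  show "a - b = a + - b"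
    by transfer (simp add: fun_eq_iff mod_add_right_eq)
  show "(a + b) * c = a * c + b * c"
    by transfer (simp add: fun_eq_iff mod_mult_left_eq mod_add_eq distrib_right)
  have "1 < int CARD('a)"
    using prime_card[where 'a = 'a] by (metis of_nat_1 of_nat_less_iff prime_gt_1_nat)
  then show "(0::'a padic_int) \<noteq> 1"
    by transfer (auto simp add: fun_eq_iff intro!: exI[of _ 1])
qed

end

abbreviation prime_elem_p :: "'p::prime_card padic_int" (\<open>\<p>\<close>)
  where "\<p> \<equiv> of_nat CARD('p)"

definition padic_cong :: "nat \<Rightarrow> 'p::prime_card padic_int \<Rightarrow> 'p padic_int \<Rightarrow> bool"
  where "padic_cong k x y \<longleftrightarrow> \<p> ^ k dvd x - y"


section \<open>The \<open>p\<close>-adic topology and \<open>p\<close>-adic powers\<close>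

instantiation padic_int :: (prime_card) topological_space
begin

definition open_padic_int :: "'a padic_int set \<Rightarrow> bool"
  where "open_padic_int U \<longleftrightarrow> (\<forall>x\<in>U. \<exists>k. \<forall>y. padic_cong k y x \<longrightarrow> y \<in> U)"

instance
proof
  show "open (UNIV :: 'a padic_int set)"
    by (simp add: open_padic_int_def)
next
  fix S T :: "'a padic_int set"
  assume S: "open S" and T: "open T"
  show "open (S \<inter> T)"
    unfolding open_padic_int_def
  proof
    fix x assume "x \<in> S \<inter> T"
    then obtain k l where k: "\<And>y. padic_cong k y x \<Longrightarrow> y \<in> S" and l: "\<And>y. padic_cong l y x \<Longrightarrow> y \<in> T"
      using S T unfolding open_padic_int_def by blast
    have "y \<in> S \<inter> T" if "padic_cong (max k l) y x" for y
    proof -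
      have "padic_cong k y x" "padic_cong l y x"
        using that unfolding padic_cong_def by (meson dvd_trans le_imp_power_dvd max.cobounded1 max.cobounded2)+
      with k l show ?thesis by blast
    qed
    then show "\<exists>k. \<forall>y. padic_cong k y x \<longrightarrow> y \<in> S \<inter> T" by blast
  qed
next
  fix K :: "'a padic_int set set"
  assume K: "\<forall>S\<in>K. open S"
  show "open (\<Union>K)"
    unfolding open_padic_int_def
  proof
    fix x assume "x \<in> \<Union>K"
    then obtain S where S: "S \<in> K" "x \<in> S" by blast
    with K obtain k where "\<forall>y. padic_cong k y x \<longrightarrow> y \<in> S"
      unfolding open_padic_int_def by meson
    with S show "\<exists>k. \<forall>y. padic_cong k y x \<longrightarrow> y \<in> \<Union>K" by (meson UnionI)
  qed
qed

end

lemma tendsto_padic_int_iff: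
  "(f \<longlongrightarrow> l) F \<longleftrightarrow> (\<forall>k. \<forall>\<^sub>F n in F. padic_cong k (f n) (l :: 'p::prime_card padic_int))"
proof
  assume lim: "(f \<longlongrightarrow> l) F"
  show "\<forall>k. \<forall>\<^sub>F n in F. padic_cong k (f n) l"
  proof
    fix k
    have "open {y. padic_cong k y l}"
      unfolding open_padic_int_def
    proof (intro ballI exI[of _ k] allI impI)
      fix x y assume "x \<in> {y. padic_cong k y l}" "padic_cong k y x"
      then show "y \<in> {y. padic_cong k y l}"
        unfolding padic_cong_def using dvd_add[of "\<p> ^ k" "y - x" "x - l"] by simp
    qed
    then show "\<forall>\<^sub>F n in F. padic_cong k (f n) l"
      using topological_tendstoD[OF lim] by (fastforce simp: padic_cong_def)
  qed
next
  assume *: "\<forall>k. \<forall>\<^sub>F n in F. padic_cong k (f n) l"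
  show "(f \<longlongrightarrow> l) F"
  proof (rule topological_tendstoI)
    fix S assume "open S" "l \<in> S"
    then obtain k where "\<And>y. padic_cong k y l \<Longrightarrow> y \<in> S"
      unfolding open_padic_int_def by blast
    then show "\<forall>\<^sub>F n in F. f n \<in> S"
      by (intro eventually_mono[OF *[rule_format, of k]]) blast
  qed
qed

text \<open>
  The power \<open>u\<^sup>a\<close> with \<open>p\<close>-adic exponent, meaningful for \<open>u \<equiv> 1 (mod p)\<close>.
\<close>

definition padic_power :: "'p::prime_card padic_int \<Rightarrow> 'p padic_int \<Rightarrow> 'p padic_int"
  where "padic_power u a = (THE y. \<forall>X :: nat \<Rightarrow> nat.
    (\<lambda>n. of_nat (X n)) \<longlonglongrightarrow> a \<longrightarrow> (\<lambda>n. u ^ X n) \<longlonglongrightarrow> y)"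


section \<open>Automorphisms of the system with one operation and all congruences\<close>

definition padic_automorphism ::
    "('p::prime_card padic_int \<Rightarrow> 'p padic_int \<Rightarrow> 'p padic_int) \<Rightarrow> ('p padic_int \<Rightarrow> 'p padic_int) \<Rightarrow> bool"
  where "padic_automorphism star f \<longleftrightarrow>
    bij f \<and>
    (\<forall>x y. f (star x y) = star (f x) (f y)) \<and>
    (\<forall>k\<ge>1. \<forall>x y. padic_cong k x y \<longrightarrow> padic_cong k (f x) (f y))"

definition padic_Aut ::
    "('p::prime_card padic_int \<Rightarrow> 'p padic_int \<Rightarrow> 'p padic_int) \<Rightarrow> ('p padic_int \<Rightarrow> 'p padic_int) monoid"
  where "padic_Aut star = \<lparr>carrier = {f. padic_automorphism star f}, monoid.mult = (\<circ>), one = id\<rparr>"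

lemma residue_range: "residue (x :: 'p::prime_card padic_int) n \<in> {0..<int CARD('p) ^ n}"
  and residue_Suc: "residue x (Suc n) mod int CARD('p) ^ n = residue x n"
  using residue[of x] by auto

lemma residue_mod [simp]: "residue (x :: 'p::prime_card padic_int) n mod int CARD('p) ^ n = residue x n"
  using residue_range[of x n] by simp

lemma residue_of_nat: "residue (of_nat m :: 'p::prime_card padic_int) n = int m mod int CARD('p) ^ n"
proof (induction m)
  case 0 then show ?case by (simp add: zero_padic_int.rep_eq)
next
  case (Suc m)
  then show ?case
    by (simp add: plus_padic_int.rep_eq one_padic_int.rep_eq mod_add_eq)
qed

lemma residue_add_mod: "residue (x :: 'p::prime_card padic_int) (n + k) mod int CARD('p) ^ n = residue x n"
proof (induction k)
  case (Suc k)
  have "int CARD('p) ^ n dvd int CARD('p) ^ (n + k)" by (simp add: le_imp_power_dvd)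
  then have "residue x (n + Suc k) mod int CARD('p) ^ n
      = (residue x (Suc (n + k)) mod int CARD('p) ^ (n + k)) mod int CARD('p) ^ n"
    by (simp add: mod_mod_cancel)
  with Suc show ?case by (simp add: residue_Suc)
qed simp

lemma padic_cong_iff_residue:
  "padic_cong k x y \<longleftrightarrow> residue x k = residue (y :: 'p::prime_card padic_int) k"
proof
  assume "padic_cong k x y"
  then obtain z where "x - y = of_nat (CARD('p) ^ k) * z"
    unfolding padic_cong_def dvd_def by auto
  then have "residue (x - y) k = 0"
    by (simp only: times_padic_int.rep_eq residue_of_nat) simp
  then have "(residue x k - residue y k) mod int CARD('p) ^ k = 0"
    by (simp add: minus_padic_int.rep_eq)
  then have "residue x k mod int CARD('p) ^ k = residue y k mod int CARD('p) ^ k"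
    by (simp only: mod_eq_dvd_iff mod_eq_0_iff_dvd)
  then show "residue x k = residue y k" by simp
next
  let ?q = "int CARD('p)"
  assume eq: "residue x k = residue y k"
  define w where "w = x - y"
  define d where "d n = residue w (n + k) div ?q ^ k" for n
  have "residue w k = 0"
    using eq by (simp add: w_def minus_padic_int.rep_eq)
  then have dvd: "?q ^ k dvd residue w (n + k)" for n
    using residue_add_mod[of w k n] by (simp add: add.commute mod_eq_0_iff_dvd)
  have d: "residue w (n + k) = ?q ^ k * d n" for n
    using dvd[of n] by (simp add: d_def)
  have dmod: "d (Suc n) mod ?q ^ n = d n mod ?q ^ n" for n
  proof -
    have "?q ^ (n + k) dvd residue w (Suc (n + k)) - residue w (n + k)"
      using residue_Suc[of w "n + k"] by (metis mod_eq_dvd_iff residue_mod)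
    then have "?q ^ k * ?q ^ n dvd ?q ^ k * (d (Suc n) - d n)"
      using d[of n] d[of "Suc n"] by (simp add: power_add algebra_simps)
    then show ?thesis by (simp add: mod_eq_dvd_iff)
  qed
  define z :: "'p padic_int" where "z = Abs_padic_int (\<lambda>n. d n mod ?q ^ n)"
  have z: "residue z n = d n mod ?q ^ n" for n
    unfolding z_def using padic_lift_mod[of d, where 'p = 'p, OF dmod]
    by (subst Abs_padic_int_inverse) auto
  have "residue w n = residue (of_nat (CARD('p) ^ k) * z) n" for n
  proof -
    have "residue w n = residue w (n + k) mod ?q ^ n"
      by (rule residue_add_mod[symmetric])
    also have "\<dots> = (?q ^ k * d n) mod ?q ^ n" by (simp only: d)
    also have "\<dots> = residue (of_nat (CARD('p) ^ k) * z) n"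
      by (simp only: times_padic_int.rep_eq residue_of_nat z) (simp add: mod_mult_eq)
    finally show ?thesis .
  qed
  then have "w = of_nat (CARD('p) ^ k) * z"
    by (simp add: residue_inject[symmetric] fun_eq_iff)
  then show "padic_cong k x y"
    unfolding padic_cong_def w_def by simp
qed

lemma padic_cong_reflect:
  fixes f :: "'p::prime_card padic_int \<Rightarrow> 'p padic_int"
  assumes surj: "surj f" and f: "\<And>x y. padic_cong k x y \<Longrightarrow> padic_cong k (f x) (f y)"
    and c: "padic_cong k (f x) (f y)"
  shows "padic_cong k x y"
proof -
  let ?R = "{0..<int CARD('p) ^ k}"
  define g where "g r = residue (f (of_nat (nat r))) k" for r :: int
  have g: "g (residue x k) = residue (f x) k" for x
  proof -
    have "residue (of_nat (nat (residue x k)) :: 'p padic_int) k = residue x k"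
      using residue_range[of x k] by (simp add: residue_of_nat del: of_nat_nat)
    then show ?thesis
      using f[of "of_nat (nat (residue x k))" x]
      by (simp add: g_def padic_cong_iff_residue del: of_nat_nat)
  qed
  have "?R \<subseteq> g ` ?R"
  proof
    fix r assume r: "r \<in> ?R"
    obtain x where x: "f x = of_nat (nat r)" using surj by (metis surjD)
    have "r = g (residue x k)" using r by (simp add: g x residue_of_nat del: of_nat_nat)
    then show "r \<in> g ` ?R" using residue_range[of x k] by blast
  qed
  then have "inj_on g ?R"
    by (metis card_image_le card_mono eq_card_imp_inj_on finite_atLeastLessThan_int finite_imageI le_antisym)
  moreover have "g (residue x k) = g (residue y k)"
    using c by (simp add: g padic_cong_iff_residue)
  ultimately have "residue x k = residue y k"
    using residue_range[of x k] residue_range[of y k] by (rule inj_onD)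
  then show ?thesis by (simp only: padic_cong_iff_residue)
qed

lemma group_padic_Aut: "group (padic_Aut star)"
proof (rule groupI)
  fix f assume "f \<in> carrier (padic_Aut star)"
  then have f: "bij f" "\<And>x y. f (star x y) = star (f x) (f y)"
    "\<And>k x y. k \<ge> 1 \<Longrightarrow> padic_cong k x y \<Longrightarrow> padic_cong k (f x) (f y)"
    by (auto simp: padic_Aut_def padic_automorphism_def)
  have inv: "f (inv_into UNIV f x) = x" for x
    using f(1) by (simp add: bij_is_surj surj_f_inv_f)
  have "padic_automorphism star (inv_into UNIV f)"
    unfolding padic_automorphism_def
  proof (intro conjI allI impI)
    show "bij (inv_into UNIV f)" using f(1) by (rule bij_imp_bij_inv)
    show "inv_into UNIV f (star x y) = star (inv_into UNIV f x) (inv_into UNIV f y)" for x y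
      by (metis bij_inv_eq_iff f(1,2))
    show "padic_cong k (inv_into UNIV f x) (inv_into UNIV f y)" if "1 \<le> k" "padic_cong k x y" for k x y
      by (rule padic_cong_reflect[of f]) (use f that in \<open>auto simp: inv bij_is_surj\<close>)
  qed
  moreover have "inv_into UNIV f \<circ> f = id" using f(1) by (simp add: bij_is_inj)
  ultimately show "\<exists>g\<in>carrier (padic_Aut star). g \<otimes>\<^bsub>padic_Aut star\<^esub> f = \<one>\<^bsub>padic_Aut star\<^esub>"
    by (auto simp: padic_Aut_def)
qed (auto simp: padic_Aut_def padic_automorphism_def bij_comp fun_eq_iff)

end

theory Submission
  imports Defs "HOL-Number_Theory.Residue_Primitive_Roots"
begin

text \<open>
  An automorphism \<open>f\<close> respects all congruences, so it is continuous and is determined by its values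
  on a set that generates a dense subsystem.  Since \<open>f\<close> permutes the residue classes modulo each
  \<open>p\<^sup>k\<close>, it also reflects congruences (\<open>automorphism_cong_iff\<close>).

  For addition the natural numbers are dense and generated by \<open>1\<close>, so \<open>f(x) = f(1) x\<close>; reflection
  of congruences modulo \<open>p\<close> makes \<open>f(1)\<close> a unit.

  For multiplication every nonzero element is \<open>p\<^sup>k \<theta> u\<close> with \<open>\<theta>\<close> a root of unity of order dividing
  \<open>p - 1\<close> and \<open>u \<equiv> 1 (mod p)\<close> (\<open>teichmueller_representation\<close>), and \<open>f\<close> acts on the three factors
  separately.  Divisibility by powers of \<open>p\<close> is preserved in both directions, hence \<open>f(p) = p A\<close> with
  \<open>A\<close> a unit.  The roots of unity form a cyclic group of order \<open>p - 1\<close>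
  (\<open>root_of_unity_generator\<close>), whose automorphisms are the powers with exponent \<open>s\<close> coprime to
  \<open>p - 1\<close>.  For odd \<open>p\<close> the principal units \<open>u \<equiv> 1 (mod p)\<close> are exactly the \<open>p\<close>-adic powers of
  \<open>1 + p\<close> (\<open>topological_generator\<close>), so that \<open>f\<close> is \<open>u \<mapsto> u\<^sup>a\<close> on them, where
  \<open>f(1 + p) = (1 + p)\<^sup>a\<close>; if \<open>p\<close> divided \<open>a\<close>, the value \<open>f(1 + p)\<close> would be \<open>1\<close> modulo \<open>p\<^sup>2\<close>,
  which \<open>1 + p\<close> is not.  For \<open>p = 2\<close> the powers of \<open>5\<close> only give the units \<open>u \<equiv> 1 (mod 4)\<close>; the others
  are their negatives, and \<open>f(-1) = -1 = (-1)\<^sup>a\<close> because \<open>-1\<close> is the only element of order two and \<open>a\<close>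
  is odd.

  Conversely, a map of the stated form is multiplicative since it is so on each factor, it respects
  congruences because \<open>u \<mapsto> u\<^sup>a\<close> does and congruent units have the same \<open>\<theta>\<close>, and it is bijective
  because \<open>A\<close>, \<open>s\<close> and \<open>a\<close> are invertible in their respective rings.
\<close>

(* The modulus p is p ^ 1: the literal 1 has to survive simplification so that facts about
   "padic_cong 1" keep matching. *)
declare One_nat_def [simp del]

section \<open>Congruences modulo powers of \<open>p\<close>\<close>

lemma padic_cong_refl [simp]: "padic_cong k x x"
  by (simp add: padic_cong_iff_residue)

lemma padic_cong_sym: "padic_cong k x y \<Longrightarrow> padic_cong k y x"
  by (simp add: padic_cong_iff_residue)

lemma padic_cong_trans [trans]: "padic_cong k x y \<Longrightarrow> padic_cong k y z \<Longrightarrow> padic_cong k x z"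
  by (simp add: padic_cong_iff_residue)

lemma padic_cong_add:
  "padic_cong k x y \<Longrightarrow> padic_cong k x' y' \<Longrightarrow> padic_cong k (x + x') (y + y')"
  by (simp add: padic_cong_iff_residue plus_padic_int.rep_eq)

lemma padic_cong_mult:
  "padic_cong k x y \<Longrightarrow> padic_cong k x' y' \<Longrightarrow> padic_cong k (x * x') (y * y')"
  by (simp add: padic_cong_iff_residue times_padic_int.rep_eq)

lemma padic_cong_power: "padic_cong k x y \<Longrightarrow> padic_cong k (x ^ n) (y ^ n)"
  by (induction n) (auto intro: padic_cong_mult)

lemma padic_cong_sum:
  "(\<And>i. i \<in> I \<Longrightarrow> padic_cong k (f i) (g i)) \<Longrightarrow> padic_cong k (sum f I) (sum g I)"
  by (induction I rule: infinite_finite_induct) (auto intro: padic_cong_add)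

lemma padic_cong_mono: "padic_cong k x y \<Longrightarrow> l \<le> k \<Longrightarrow> padic_cong l x y"
  unfolding padic_cong_def by (meson dvd_trans le_imp_power_dvd)

lemma padic_cong_0 [simp]: "padic_cong 0 x y"
  by (simp add: padic_cong_def)

lemma padic_cong_0_right: "padic_cong k x 0 \<longleftrightarrow> \<p> ^ k dvd x"
  by (simp add: padic_cong_def)

lemma padic_cong_p_power_dvd_iff:
  assumes "padic_cong n x y" "m \<le> n"
  shows "\<p> ^ m dvd x \<longleftrightarrow> \<p> ^ m dvd y"
  using padic_cong_mono[OF assms] padic_cong_sym padic_cong_trans by (metis padic_cong_0_right)

lemma padic_cong_imp_eq: "(\<And>k. padic_cong k x y) \<Longrightarrow> x = y"
  by (simp add: padic_cong_iff_residue residue_inject[symmetric] fun_eq_iff)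

lemma padic_cong_of_nat:
  "padic_cong k (of_nat m :: 'p::prime_card padic_int) (of_nat n) \<longleftrightarrow> [m = n] (mod CARD('p) ^ k)"
  by (simp add: padic_cong_iff_residue residue_of_nat cong_def flip: of_nat_power zmod_int)

text \<open>
  Density of the natural numbers; this replaces sequences and limits in most arguments below.
\<close>

lemma padic_nat_approximation:
  obtains m where "padic_cong k (of_nat m) (x :: 'p::prime_card padic_int)"
proof
  show "padic_cong k (of_nat (nat (residue x k))) x"
    using residue_range[of x k] by (simp add: padic_cong_iff_residue residue_of_nat del: of_nat_nat)
qed

text \<open>
  The limit of a sequence whose terms stabilise modulo each \<open>p\<^sup>n\<close> is its diagonal of residues.
\<close>

lemma padic_complete:
  fixes X :: "nat \<Rightarrow> 'p::prime_card padic_int"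
  assumes "\<And>n. padic_cong n (X (Suc n)) (X n)"
  obtains l where "\<And>n. padic_cong n (X n) l"
proof
  define l :: "'p padic_int" where "l = Abs_padic_int (\<lambda>n. residue (X n) n)"
  have "residue (X (Suc n)) (Suc n) mod int CARD('p) ^ n = residue (X n) n" for n
    using assms[of n] by (simp add: residue_Suc padic_cong_iff_residue)
  then have "residue l n = residue (X n) n" for n
    unfolding l_def using residue_range[of "X _"] by (subst Abs_padic_int_inverse) auto
  then show "padic_cong n (X n) (Abs_padic_int (\<lambda>n. residue (X n) n))" for n
    by (simp add: padic_cong_iff_residue l_def)
qed

lemma p_gt_1: "1 < CARD('p::prime_card)"
  using prime_card[where 'a = 'p] by (rule prime_gt_1_nat)

lemma mult_power_p_minus_1: "x * x ^ (CARD('p::prime_card) - 1) = (x :: 'p padic_int) ^ CARD('p)"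
  and mult_power_p_minus_2: "x * x ^ (CARD('p::prime_card) - 2) = (x :: 'p padic_int) ^ (CARD('p) - 1)"
proof -
  have "Suc (CARD('p) - 1) = CARD('p)" "Suc (CARD('p) - 2) = CARD('p) - 1"
    using p_gt_1[where 'p = 'p] by linarith+
  then show "x * x ^ (CARD('p) - 1) = x ^ CARD('p)" "x * x ^ (CARD('p) - 2) = x ^ (CARD('p) - 1)"
    by (simp_all flip: power_Suc)
qed

section \<open>The \<open>p\<close>-adic integers form an integral domain\<close>

text \<open>
  Multiplication by \<open>p\<close> costs one digit: the residue of \<open>p x\<close> modulo \<open>p\<^sup>n\<^sup>+\<^sup>1\<close> determines that of \<open>x\<close>
  modulo \<open>p\<^sup>n\<close>.
\<close>

lemma p_mult_eq_0:
  assumes "\<p> * x = (0 :: 'p::prime_card padic_int)"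
  shows "x = 0"
proof (rule padic_cong_imp_eq)
  fix n
  let ?q = "int CARD('p)"
  have "?q * residue x (Suc n) mod ?q ^ Suc n = residue (\<p> * x) (Suc n)"
    by (simp only: times_padic_int.rep_eq residue_of_nat) (simp add: mod_mult_left_eq)
  also have "\<dots> = 0"
    by (simp add: assms zero_padic_int.rep_eq)
  finally have "?q ^ n dvd residue x (Suc n)"
    by (simp add: mod_eq_0_iff_dvd)
  then show "padic_cong n x 0"
    using residue_Suc[of x n] by (simp add: padic_cong_iff_residue zero_padic_int.rep_eq mod_eq_0_iff_dvd)
qed

lemma p_power_mult_eq_0: "\<p> ^ k * x = (0 :: 'p::prime_card padic_int) \<Longrightarrow> x = 0"
  by (induction k) (auto simp: mult.assoc dest: p_mult_eq_0)

text \<open>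
  Euclid's lemma, transported from the natural numbers by approximating both factors modulo \<open>p\<close>.
\<close>

lemma p_dvd_mult:
  fixes x y :: "'p::prime_card padic_int"
  assumes "\<p> dvd x * y"
  shows "\<p> dvd x \<or> \<p> dvd y"
proof -
  obtain m n where m: "padic_cong 1 (of_nat m) x" and n: "padic_cong 1 (of_nat n) y"
    using padic_nat_approximation by metis
  have "padic_cong 1 (of_nat (m * n)) (of_nat 0 :: 'p padic_int)"
    using padic_cong_trans[OF padic_cong_mult[OF m n], of 0] assms by (simp add: padic_cong_0_right)
  then have "CARD('p) dvd m \<or> CARD('p) dvd n"
    using prime_card[where 'a = 'p]
    by (auto simp only: padic_cong_of_nat prime_dvd_mult_iff cong_0_iff power_one_right)
  then have "padic_cong 1 (of_nat m) (of_nat 0 :: 'p padic_int) \<or> padic_cong 1 (of_nat n) (of_nat 0 :: 'p padic_int)"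
    by (simp only: padic_cong_of_nat cong_0_iff power_one_right)
  then show ?thesis
    using padic_cong_trans[OF padic_cong_sym[OF m], of 0] padic_cong_trans[OF padic_cong_sym[OF n], of 0]
    by (auto simp: padic_cong_0_right)
qed

lemma padic_valuation:
  fixes x :: "'p::prime_card padic_int"
  assumes "x \<noteq> 0"
  obtains k y where "x = \<p> ^ k * y" "\<not> padic_cong 1 y 0"
proof -
  define n where "n = (LEAST n. \<not> padic_cong n x 0)"
  have ex: "\<exists>n. \<not> padic_cong n x 0"
    using assms padic_cong_imp_eq by blast
  have n: "\<not> padic_cong n x 0"
    unfolding n_def by (rule LeastI_ex[OF ex])
  then obtain k where k: "n = Suc k"
    by (cases n) auto
  then have "padic_cong k x 0"
    using not_less_Least[of k "\<lambda>n. \<not> padic_cong n x 0"] by (auto simp: n_def)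
  then obtain y where y: "x = \<p> ^ k * y"
    by (auto simp: padic_cong_0_right)
  have "\<not> padic_cong 1 y 0"
    using n by (auto simp: k y padic_cong_0_right mult.commute intro: mult_dvd_mono)
  with y that show thesis by blast
qed

instance padic_int :: (prime_card) idom
proof
  fix x y :: "'a padic_int"
  assume "x \<noteq> 0" "y \<noteq> 0"
  then obtain k x' l y' where x: "x = \<p> ^ k * x'" "\<not> padic_cong 1 x' 0"
    and y: "y = \<p> ^ l * y'" "\<not> padic_cong 1 y' 0"
    by (metis padic_valuation)
  have "x * y = \<p> ^ (k + l) * (x' * y')"
    by (simp add: x y power_add algebra_simps)
  moreover have "x' * y' \<noteq> 0"
    using p_dvd_mult[of x' y'] x y by (auto simp: padic_cong_0_right)
  ultimately show "x * y \<noteq> 0"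
    using p_power_mult_eq_0 by metis
qed

lemma p_nonzero [simp]: "\<p> \<noteq> (0 :: 'p::prime_card padic_int)"
  using p_mult_eq_0[of 1] by auto

lemma not_padic_cong_1_0 [simp]: "\<not> padic_cong 1 (1 :: 'p::prime_card padic_int) 0"
  using p_gt_1[where 'p = 'p] padic_cong_of_nat[of 1 1 0, where 'p = 'p] by (simp add: cong_0_iff)

lemma padic_cong_p_power_mult_iff:
  "padic_cong (k + n) (\<p> ^ k * x) (\<p> ^ k * y) \<longleftrightarrow> padic_cong n x (y :: 'p::prime_card padic_int)"
proof -
  have "\<p> ^ k * x - \<p> ^ k * y = \<p> ^ k * (x - y)"
    by (simp add: algebra_simps)
  then show ?thesis
    by (simp add: padic_cong_def power_add)
qed

lemma nonunit_mult_iff: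
  "padic_cong 1 (x * y) 0 \<longleftrightarrow> padic_cong 1 x 0 \<or> padic_cong 1 (y :: 'p::prime_card padic_int) 0"
  using p_dvd_mult[of x y] by (auto simp: padic_cong_0_right)

lemma nonunit_power: "padic_cong 1 (x ^ n) 0 \<Longrightarrow> padic_cong 1 (x :: 'p::prime_card padic_int) 0"
proof (induction n)
  case (Suc n)
  then show ?case using nonunit_mult_iff[of x "x ^ n"] by auto
qed simp

section \<open>Powers with \<open>p\<close>-adic exponents\<close>

text \<open>
  In \<open>x\<^sup>p - y\<^sup>p = (x - y) \<Sum> y\<^sup>p\<^sup>-\<^sup>1\<^sup>-\<^sup>i x\<^sup>i\<close> all \<open>p\<close> summands of the second factor agree modulo \<open>p\<close>, so
  this factor contributes another \<open>p\<close>.  This gain of one digit per \<open>p\<close>-th power drives the convergence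
  of \<open>p\<close>-adic powers and of the Teichmueller sequence.
\<close>

lemma padic_cong_power_p:
  fixes x y :: "'p::prime_card padic_int"
  assumes xy: "padic_cong n x y" and "1 \<le> n"
  shows "padic_cong (Suc n) (x ^ CARD('p)) (y ^ CARD('p))"
proof -
  define S where "S = (\<Sum>i<CARD('p). y ^ (CARD('p) - Suc i) * x ^ i)"
  have "padic_cong 1 S (\<Sum>i<CARD('p). y ^ (CARD('p) - 1))"
    unfolding S_def
  proof (rule padic_cong_sum)
    fix i assume i: "i \<in> {..<CARD('p)}"
    have "padic_cong 1 (y ^ (CARD('p) - Suc i) * x ^ i) (y ^ (CARD('p) - Suc i) * y ^ i)"
      using padic_cong_mono[OF assms] by (intro padic_cong_mult padic_cong_power padic_cong_refl)
    then show "padic_cong 1 (y ^ (CARD('p) - Suc i) * x ^ i) (y ^ (CARD('p) - 1))"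
      using i by (simp add: One_nat_def flip: power_add)
  qed
  also have "padic_cong 1 (\<Sum>i<CARD('p). y ^ (CARD('p) - 1)) 0"
    by (simp add: padic_cong_0_right)
  finally have "\<p> dvd S"
    by (simp add: padic_cong_0_right)
  then have "\<p> ^ n * \<p> dvd (x - y) * S"
    using xy by (intro mult_dvd_mono) (auto simp: padic_cong_def)
  then show ?thesis
    by (simp add: padic_cong_def S_def power_diff_sumr2 mult.commute)
qed

lemma padic_cong_power_p_power:
  fixes x y :: "'p::prime_card padic_int"
  assumes "padic_cong 1 x y"
  shows "padic_cong (Suc n) (x ^ (CARD('p) ^ n)) (y ^ (CARD('p) ^ n))"
proof (induction n)
  case (Suc n)
  then show ?case
    using padic_cong_power_p[OF Suc] by (simp add: mult.commute flip: power_mult)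
qed (use assms in \<open>simp add: One_nat_def\<close>)

lemma padic_cong_power_exponent:
  fixes u :: "'p::prime_card padic_int"
  assumes u: "padic_cong 1 u 1" and "[m = m'] (mod CARD('p) ^ n)"
  shows "padic_cong (Suc n) (u ^ m) (u ^ m')"
proof -
  have *: "padic_cong (Suc n) (u ^ (l + CARD('p) ^ n * j)) (u ^ l)" for l j
  proof -
    have "padic_cong (Suc n) (u ^ l * (u ^ (CARD('p) ^ n)) ^ j) (u ^ l * (1 ^ (CARD('p) ^ n)) ^ j)"
      using u by (intro padic_cong_mult padic_cong_power padic_cong_power_p_power padic_cong_refl)
    then show ?thesis
      by (simp add: power_add power_mult)
  qed
  obtain k l where "m + k * CARD('p) ^ n = m' + l * CARD('p) ^ n"
    using assms(2) unfolding cong_iff_lin_nat by metis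
  then show ?thesis
    using *[of m k] *[of m' l] by (metis mult.commute padic_cong_sym padic_cong_trans)
qed

text \<open>
  A quantitative form of the definition of \<open>u\<^sup>a\<close>: an exponent known to \<open>n\<close> digits gives the power
  to \<open>n + 1\<close> digits.  In particular the limit in the definition exists, and all properties of
  \<open>u\<^sup>a\<close> reduce to those of powers with natural exponents.
\<close>

lemma padic_cong_padic_power:
  fixes u :: "'p::prime_card padic_int"
  assumes u: "padic_cong 1 u 1" and m: "padic_cong n (of_nat m) a"
  shows "padic_cong (Suc n) (u ^ m) (padic_power u a)"
proof -
  define X where "X n = nat (residue a n)" for n
  have X: "padic_cong n (of_nat (X n)) a" for n
    using residue_range[of a n]
    by (simp add: X_def padic_cong_iff_residue residue_of_nat del: of_nat_nat)
  have exponent: "padic_cong (Suc n) (u ^ m) (u ^ m')"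
    if "padic_cong n (of_nat m) a" "padic_cong n (of_nat m') a" for n m m'
    using padic_cong_trans[OF that(1) padic_cong_sym[OF that(2)]]
    by (intro padic_cong_power_exponent u) (simp add: padic_cong_of_nat)
  have "padic_cong n (u ^ X (Suc n)) (u ^ X n)" for n
    by (rule padic_cong_mono[OF exponent[of n]]) (use X padic_cong_mono[OF X, of n "Suc n"] in auto)
  then obtain y where y: "\<And>n. padic_cong n (u ^ X n) y"
    using padic_complete[of "\<lambda>n. u ^ X n"] by blast
  have approx: "padic_cong (Suc n) (u ^ m) y" if "padic_cong n (of_nat m) a" for m n
  proof -
    have "padic_cong (Suc n) (u ^ m) (u ^ X (Suc n))"
      using that padic_cong_mono[OF X, of n "Suc n"] by (intro exponent) auto
    with y show ?thesis by (blast intro: padic_cong_trans)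
  qed
  have lim: "(\<lambda>n. u ^ Y n) \<longlonglongrightarrow> y" if "(\<lambda>n. of_nat (Y n)) \<longlonglongrightarrow> a" for Y
    unfolding tendsto_padic_int_iff
  proof
    fix k
    have "\<forall>\<^sub>F n in sequentially. padic_cong k (of_nat (Y n)) a"
      using that by (simp add: tendsto_padic_int_iff)
    then show "\<forall>\<^sub>F n in sequentially. padic_cong k (u ^ Y n) y"
      by (rule eventually_mono) (rule padic_cong_mono[OF approx], auto)
  qed
  \<comment> \<open>The definition asks for the limit along all exponent sequences; uniqueness only needs the sequence \<open>X\<close>.\<close>
  have "padic_power u a = y"
    unfolding padic_power_def
  proof (rule the_equality)
    fix z assume z: "\<forall>Y. (\<lambda>n. of_nat (Y n)) \<longlonglongrightarrow> a \<longrightarrow> (\<lambda>n. u ^ Y n) \<longlonglongrightarrow> z"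
    have "(\<lambda>n. of_nat (X n)) \<longlonglongrightarrow> a"
      unfolding tendsto_padic_int_iff eventually_sequentially using padic_cong_mono[OF X] by blast
    then have "(\<lambda>n. u ^ X n) \<longlonglongrightarrow> z" "(\<lambda>n. u ^ X n) \<longlonglongrightarrow> y"
      using z lim by auto
    then have "\<forall>\<^sub>F n in sequentially. padic_cong k (u ^ X n) z \<and> padic_cong k (u ^ X n) y" for k
      by (simp add: tendsto_padic_int_iff eventually_conj)
    then have "padic_cong k z y" for k
      using eventually_happens[of _ sequentially] padic_cong_sym padic_cong_trans by fastforce
    then show "z = y"
      by (rule padic_cong_imp_eq)
  qed (use lim in blast)
  with approx[OF m] show ?thesis by simp
qed

lemma padic_power_cong:
  fixes u :: "'p::prime_card padic_int"
  assumes "padic_cong 1 u 1" "padic_cong 1 v 1" "padic_cong n u v"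
  shows "padic_cong n (padic_power u a) (padic_power v a)"
proof -
  obtain m where m: "padic_cong n (of_nat m) a"
    using padic_nat_approximation by blast
  have "padic_cong n (u ^ m) (v ^ m)"
    using assms(3) by (rule padic_cong_power)
  with padic_cong_padic_power[OF assms(1) m] padic_cong_padic_power[OF assms(2) m]
  show ?thesis
    by (meson padic_cong_mono padic_cong_sym padic_cong_trans le_SucI order_refl)
qed

lemma padic_power_cong_1: "padic_cong 1 u 1 \<Longrightarrow> padic_cong 1 (padic_power u a) 1"
  using padic_cong_padic_power[of u 0 0 a] by (auto simp: One_nat_def intro: padic_cong_sym)

lemma padic_power_eqI:
  fixes u :: "'p::prime_card padic_int"
  assumes "padic_cong 1 u 1" "\<And>n m. padic_cong n (of_nat m) a \<Longrightarrow> padic_cong n (u ^ m) y"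
  shows "padic_power u a = y"
proof (rule padic_cong_imp_eq)
  fix n
  obtain m where m: "padic_cong n (of_nat m) a"
    using padic_nat_approximation by blast
  show "padic_cong n (padic_power u a) y"
    using padic_cong_padic_power[OF assms(1) m] assms(2)[OF m]
    by (meson padic_cong_mono padic_cong_sym padic_cong_trans le_SucI order_refl)
qed

lemma padic_power_of_nat: 
  assumes "padic_cong 1 u 1"
  shows "padic_power u (of_nat m) = u ^ m"
proof (rule padic_power_eqI[OF assms])
  fix n m' assume "padic_cong n (of_nat m') (of_nat m :: 'a padic_int)"
  then show "padic_cong n (u ^ m') (u ^ m)"
    using padic_cong_power_exponent[OF assms, of m' m n]
    by (auto simp: padic_cong_of_nat intro: padic_cong_mono)
qed

lemma padic_power_mult_base:
  fixes u v :: "'p::prime_card padic_int"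
  assumes u: "padic_cong 1 u 1" and v: "padic_cong 1 v 1"
  shows "padic_power (u * v) a = padic_power u a * padic_power v a"
proof (rule padic_power_eqI)
  show "padic_cong 1 (u * v) 1"
    using padic_cong_mult[OF u v] by simp
  fix n m assume m: "padic_cong n (of_nat m) a"
  have "padic_cong (Suc n) (u ^ m * v ^ m) (padic_power u a * padic_power v a)"
    using m u v by (intro padic_cong_mult padic_cong_padic_power)
  then show "padic_cong n ((u * v) ^ m) (padic_power u a * padic_power v a)"
    by (auto simp: power_mult_distrib intro: padic_cong_mono)
qed

lemma padic_power_add:
  fixes u :: "'p::prime_card padic_int"
  assumes u: "padic_cong 1 u 1"
  shows "padic_power u (a + b) = padic_power u a * padic_power u b"
proof (rule padic_cong_imp_eq)
  fix n
  obtain m m' where m: "padic_cong n (of_nat m) a" and m': "padic_cong n (of_nat m') b"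
    using padic_nat_approximation by metis
  have "padic_cong (Suc n) (u ^ (m + m')) (padic_power u (a + b))"
    using padic_cong_add[OF m m'] by (intro padic_cong_padic_power u) simp
  moreover have "padic_cong (Suc n) (u ^ m * u ^ m') (padic_power u a * padic_power u b)"
    using m m' u by (intro padic_cong_mult padic_cong_padic_power)
  ultimately show "padic_cong n (padic_power u (a + b)) (padic_power u a * padic_power u b)"
    by (metis padic_cong_mono padic_cong_sym padic_cong_trans le_SucI order_refl power_add)
qed

lemma padic_power_power:
  fixes u :: "'p::prime_card padic_int"
  assumes u: "padic_cong 1 u 1"
  shows "padic_power (padic_power u a) b = padic_power u (a * b)"
proof (rule padic_power_eqI[OF padic_power_cong_1[OF u]])
  fix n m' assume m': "padic_cong n (of_nat m') b"
  obtain m where m: "padic_cong n (of_nat m) a"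
    using padic_nat_approximation by blast
  have "padic_cong (Suc n) ((u ^ m) ^ m') (padic_power u a ^ m')"
    using m u by (intro padic_cong_power padic_cong_padic_power)
  moreover have "padic_cong (Suc n) (u ^ (m * m')) (padic_power u (a * b))"
    using padic_cong_mult[OF m m'] by (intro padic_cong_padic_power u) simp
  ultimately show "padic_cong n (padic_power u a ^ m') (padic_power u (a * b))"
    by (metis padic_cong_mono padic_cong_sym padic_cong_trans le_SucI order_refl power_mult)
qed

section \<open>Units and Teichmueller representatives\<close>

lemma padic_fermat:
  fixes x :: "'p::prime_card padic_int"
  assumes "\<not> padic_cong 1 x 0"
  shows "padic_cong 1 (x ^ (CARD('p) - 1)) 1"
proof -
  obtain m where m: "padic_cong 1 (of_nat m) x"
    using padic_nat_approximation by blast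
  have "\<not> padic_cong 1 (of_nat m :: 'p padic_int) (of_nat 0)"
    using assms m padic_cong_sym padic_cong_trans by fastforce
  then have "[m ^ (CARD('p) - 1) = 1] (mod CARD('p) ^ 1)"
    using fermat_theorem[OF prime_card[where 'a = 'p], of m]
    by (simp only: padic_cong_of_nat cong_0_iff power_one_right not_False_eq_True)
  then have "padic_cong 1 (of_nat m ^ (CARD('p) - 1)) (1 :: 'p padic_int)"
    by (simp only: padic_cong_of_nat[symmetric] of_nat_power of_nat_1)
  then show ?thesis
    using padic_cong_power[OF m] padic_cong_sym padic_cong_trans by blast
qed

text \<open>
  By Fermat \<open>x\<^sup>p\<^sup>-\<^sup>1\<close> is a principal unit, whose inverse is its \<open>p\<close>-adic power with exponent \<open>-1\<close>.
\<close>

lemma padic_unit: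
  fixes x :: "'p::prime_card padic_int"
  assumes "\<not> padic_cong 1 x 0"
  obtains y where "x * y = 1"
proof
  let ?u = "x ^ (CARD('p) - 1)"
  have "?u * padic_power ?u (- 1) = padic_power ?u (of_nat 1 + - 1)"
    using padic_fermat[OF assms] padic_power_of_nat[of ?u 1] by (simp only: padic_power_add power_one_right)
  also have "\<dots> = 1"
    using padic_power_of_nat[OF padic_fermat[OF assms], of 0] by simp
  finally show "x * (x ^ (CARD('p) - 2) * padic_power ?u (- 1)) = 1"
    by (simp add: mult_power_p_minus_2 flip: mult.assoc)
qed

text \<open>
  The root of unity is the limit of \<open>x, x\<^sup>p, \<dots>, x^(p^n), \<dots>\<close>, which is a fixed point of the Frobenius
  power \<open>\<theta> \<mapsto> \<theta>\<^sup>p\<close>.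
\<close>

lemma teichmueller_exists:
  fixes x :: "'p::prime_card padic_int"
  assumes x: "\<not> padic_cong 1 x 0"
  obtains \<theta> where "\<theta> ^ (CARD('p) - 1) = 1" "padic_cong 1 x \<theta>"
proof -
  let ?q = "CARD('p)"
  let ?X = "\<lambda>n. x ^ (?q ^ n)"
  have "padic_cong 1 (x * x ^ (?q - 1)) (x * 1)"
    by (intro padic_cong_mult padic_fermat x padic_cong_refl)
  then have "padic_cong 1 (x ^ ?q) x"
    by (simp add: mult_power_p_minus_1)
  then have step: "padic_cong (Suc n) (?X (Suc n)) (?X n)" for n
    using padic_cong_power_p_power[of "x ^ ?q" x n] by (simp add: power_mult)
  then obtain \<theta> where \<theta>: "\<And>n. padic_cong n (?X n) \<theta>"
    using padic_complete[of ?X] padic_cong_mono[OF step] by (metis le_SucI order_refl)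
  have "\<theta> ^ ?q = \<theta>"
  proof (rule padic_cong_imp_eq)
    fix n
    have "padic_cong n (?X (Suc n)) (\<theta> ^ ?q)"
      using padic_cong_power[OF \<theta>[of n], of ?q] by (simp add: mult.commute flip: power_mult)
    moreover have "padic_cong n (?X (Suc n)) \<theta>"
      using \<theta>[of "Suc n"] by (auto intro: padic_cong_mono)
    ultimately show "padic_cong n (\<theta> ^ ?q) \<theta>"
      using padic_cong_sym padic_cong_trans by blast
  qed
  then have "\<theta> * \<theta> ^ (?q - 1) = \<theta> * 1"
    by (simp add: mult_power_p_minus_1)
  moreover have cong: "padic_cong 1 x \<theta>"
    using \<theta>[of 1] step[of 0] padic_cong_sym padic_cong_trans by (simp add: One_nat_def) blast
  ultimately show thesis
    using x by (intro that[of \<theta>]) auto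
qed

text \<open>
  Roots of unity are fixed by \<open>p\<close>-th powers, and \<open>p\<^sup>n\<close>-th powers of elements congruent modulo \<open>p\<close>
  agree modulo \<open>p\<^sup>n\<^sup>+\<^sup>1\<close>.
\<close>

lemma teichmueller_unique:
  fixes \<theta> \<eta> :: "'p::prime_card padic_int"
  assumes "\<theta> ^ (CARD('p) - 1) = 1" "\<eta> ^ (CARD('p) - 1) = 1" "padic_cong 1 \<theta> \<eta>"
  shows "\<theta> = \<eta>"
proof (rule padic_cong_imp_eq)
  fix n
  have fixed: "\<zeta> ^ (CARD('p) ^ n) = \<zeta>" if "\<zeta> ^ (CARD('p) - 1) = 1" for \<zeta> :: "'p padic_int"
  proof (induction n)
    case (Suc n)
    have "\<zeta> ^ CARD('p) = \<zeta>"
      using that mult_power_p_minus_1[of \<zeta>] by simp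
    with Suc show ?case by (simp add: power_mult)
  qed simp
  show "padic_cong n \<theta> \<eta>"
    using padic_cong_power_p_power[OF assms(3), of n] assms by (auto simp: fixed intro: padic_cong_mono)
qed

lemma root_of_unity_unit:
  fixes \<theta> :: "'p::prime_card padic_int"
  assumes "\<theta> ^ (CARD('p) - 1) = 1"
  shows "\<not> padic_cong 1 \<theta> 0"
proof
  assume "padic_cong 1 \<theta> 0"
  then have "padic_cong 1 (\<theta> ^ (CARD('p) - 1)) (0 ^ (CARD('p) - 1))"
    by (rule padic_cong_power)
  then show False
    using assms p_gt_1[where 'p = 'p] by (simp add: power_0_left del: One_nat_def)
qed

lemma unit_decomposition:
  fixes x :: "'p::prime_card padic_int"
  assumes "\<not> padic_cong 1 x 0"
  obtains \<theta> u where "\<theta> ^ (CARD('p) - 1) = 1" "padic_cong 1 u 1" "x = \<theta> * u"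
proof -
  obtain \<theta> where \<theta>: "\<theta> ^ (CARD('p) - 1) = 1" "padic_cong 1 x \<theta>"
    using teichmueller_exists[OF assms] by blast
  have inv: "\<theta> * \<theta> ^ (CARD('p) - 2) = 1"
    using \<theta>(1) by (simp add: mult_power_p_minus_2)
  have "padic_cong 1 (x * \<theta> ^ (CARD('p) - 2)) (\<theta> * \<theta> ^ (CARD('p) - 2))"
    using \<theta>(2) by (intro padic_cong_mult padic_cong_refl)
  moreover have "x = \<theta> * (x * \<theta> ^ (CARD('p) - 2))"
    using inv by (metis mult.left_commute mult.right_neutral)
  ultimately show thesis
    using \<theta> inv by (intro that[of \<theta>]) auto
qed

lemma teichmueller_representation:
  fixes x :: "'p::prime_card padic_int"
  assumes "x \<noteq> 0"
  obtains k \<theta> u where "\<theta> ^ (CARD('p) - 1) = 1" "padic_cong 1 u 1" "x = \<p> ^ k * \<theta> * u"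
proof -
  obtain k y where x: "x = \<p> ^ k * y" and y: "\<not> padic_cong 1 y 0"
    using padic_valuation[OF assms] .
  obtain \<theta> u where "\<theta> ^ (CARD('p) - 1) = 1" "padic_cong 1 u 1" "y = \<theta> * u"
    using unit_decomposition[OF y] .
  then show thesis
    using x by (intro that[of \<theta> u k]) (simp_all add: mult.assoc)
qed

section \<open>A topological generator of the principal units\<close>

lemma padic_cong_power_one_plus:
  "padic_cong (2 * n) ((1 + \<p> ^ n * c) ^ i) (1 + of_nat i * (\<p> ^ n * c))"
proof (induction i)
  case (Suc i)
  let ?y = "\<p> ^ n * c"
  have "padic_cong (2 * n) ((1 + ?y) ^ i * (1 + ?y)) ((1 + of_nat i * ?y) * (1 + ?y))"
    by (intro padic_cong_mult Suc padic_cong_refl)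
  also have "padic_cong (2 * n) ((1 + of_nat i * ?y) * (1 + ?y)) (1 + of_nat (Suc i) * ?y)"
  proof -
    have "(1 + of_nat i * ?y) * (1 + ?y) - (1 + of_nat (Suc i) * ?y) = \<p> ^ (2 * n) * (of_nat i * c ^ 2)"
      by (simp add: algebra_simps power2_eq_square power_mult)
    then show ?thesis by (simp add: padic_cong_def)
  qed
  finally show ?case by (simp add: mult.commute)
qed simp

lemma odd_prime_dvd_sum_below:
  fixes p :: nat
  assumes "prime p" "p \<noteq> 2"
  shows "p dvd (\<Sum>i<p. i)"
proof -
  have "2 * (\<Sum>i<n. i) = n * (n - 1)" for n :: nat
    by (induction n) (auto simp: algebra_simps diff_mult_distrib2)
  then have "p dvd 2 * (\<Sum>i<p. i)"
    by simp
  moreover have "\<not> p dvd 2"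
    using assms primes_dvd_imp_eq two_is_prime_nat by blast
  ultimately show ?thesis
    using assms(1) prime_dvd_mult_iff by blast
qed

text \<open>
  A \<open>p\<close>-th power moves \<open>1 + p\<^sup>n c\<close> down by exactly one digit, keeping the leading digit \<open>c\<close>.  Writing
  \<open>w = 1 + p\<^sup>n c\<close> and \<open>w\<^sup>p - 1 = (w - 1) S\<close> with \<open>S = \<Sum> w\<^sup>i\<close>, this says \<open>S \<equiv> p (mod p\<^sup>2)\<close>.  The linear
  term of \<open>S\<close> is \<open>p\<^sup>n c\<close> times \<open>0 + \<dots> + (p - 1)\<close>, a sum that is divisible by \<open>p\<close> only for odd \<open>p\<close>;
  hence the case distinction on \<open>p = 2\<close>.
\<close>

lemma power_p_one_plus:
  fixes c :: "'p::prime_card padic_int"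
  assumes n: "1 \<le> n" "CARD('p) \<noteq> 2 \<or> 2 \<le> n"
  obtains c' where "(1 + \<p> ^ n * c) ^ CARD('p) = 1 + \<p> ^ Suc n * c'" "padic_cong 1 c' c"
proof -
  define w where "w = 1 + \<p> ^ n * c"
  define S where "S = (\<Sum>i<CARD('p). w ^ i)"
  have "padic_cong 2 S (\<Sum>i<CARD('p). 1 + of_nat i * (\<p> ^ n * c))"
    unfolding S_def w_def
    by (intro padic_cong_sum padic_cong_mono[OF padic_cong_power_one_plus]) (use n in auto)
  also have "(\<Sum>i<CARD('p). 1 + of_nat i * (\<p> ^ n * c)) = \<p> + of_nat (\<Sum>i<CARD('p). i) * \<p> ^ n * c"
    by (simp add: sum.distrib sum_distrib_right mult.assoc)
  also have "padic_cong 2 \<dots> (\<p> + 0)"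
  proof (intro padic_cong_add padic_cong_refl)
    have "(\<p> :: 'p padic_int) ^ 2 dvd of_nat (\<Sum>i<CARD('p). i) * \<p> ^ n"
    proof (cases "2 \<le> n")
      case True
      then show ?thesis by (simp add: le_imp_power_dvd)
    next
      case False
      with n have "CARD('p) dvd (\<Sum>i<CARD('p). i)"
        by (intro odd_prime_dvd_sum_below prime_card) auto
      then obtain m where "(\<Sum>i<CARD('p). i) = CARD('p) * m" ..
      moreover have "(\<p> :: 'p padic_int) dvd \<p> ^ n"
        using n by (simp add: dvd_power)
      ultimately show ?thesis
        by (simp add: power2_eq_square mult_dvd_mono)
    qed
    then show "padic_cong 2 (of_nat (\<Sum>i<CARD('p). i) * \<p> ^ n * c) 0"
      by (simp add: padic_cong_0_right)
  qed
  finally obtain d where "S - \<p> = \<p> ^ 2 * d"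
    by (auto simp: padic_cong_def)
  then have d: "S = \<p> + \<p> ^ 2 * d"
    by (simp add: algebra_simps)
  have "w ^ CARD('p) - 1 = (w - 1) * S"
    unfolding S_def by (rule power_diff_1_eq)
  also have "\<dots> = \<p> ^ Suc n * (c + \<p> * (c * d))"
    by (simp add: w_def d algebra_simps power2_eq_square)
  finally have "w ^ CARD('p) = 1 + \<p> ^ Suc n * (c + \<p> * (c * d))"
    by (simp add: algebra_simps)
  moreover have "padic_cong 1 (c + \<p> * (c * d)) c"
    by (simp add: padic_cong_def)
  ultimately show thesis
    unfolding w_def by (rule that)
qed

lemma generator_power_p_power:
  assumes e: "1 \<le> e" "CARD('p::prime_card) \<noteq> 2 \<or> 2 \<le> e"
  shows "\<exists>c :: 'p padic_int. (1 + \<p> ^ e) ^ (CARD('p) ^ n) = 1 + \<p> ^ (n + e) * c \<and> padic_cong 1 c 1"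
proof (induction n)
  case 0
  show ?case by (rule exI[of _ 1]) simp
next
  case (Suc n)
  then obtain c :: "'p padic_int" where c: "(1 + \<p> ^ e) ^ (CARD('p) ^ n) = 1 + \<p> ^ (n + e) * c" "padic_cong 1 c 1"
    by blast
  have "1 \<le> n + e" "CARD('p) \<noteq> 2 \<or> 2 \<le> n + e"
    using e by auto
  then obtain c' where c': "(1 + \<p> ^ (n + e) * c) ^ CARD('p) = 1 + \<p> ^ Suc (n + e) * c'" "padic_cong 1 c' c"
    by (rule power_p_one_plus)
  have "(1 + \<p> ^ e) ^ (CARD('p) ^ Suc n) = ((1 + \<p> ^ e) ^ (CARD('p) ^ n)) ^ CARD('p)"
    by (simp add: mult.commute flip: power_mult)
  also have "\<dots> = 1 + \<p> ^ (Suc n + e) * c'"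
    by (simp only: c(1) c'(1)) simp
  finally show ?case
    using padic_cong_trans[OF c'(2) c(2)] by blast
qed

text \<open>
  The exponent \<open>b\<close> is found digit by digit.  Let \<open>g = 1 + p\<^sup>e\<close>.  If \<open>g\<^sup>m\<close> agrees with \<open>u\<close> modulo
  \<open>p\<^sup>n\<^sup>+\<^sup>e\<close>, then replacing \<open>m\<close> by \<open>m + p\<^sup>n j\<close> multiplies by a factor \<open>1 + p\<^sup>n\<^sup>+\<^sup>e c\<close> raised to \<open>j\<close>, with
  \<open>c \<equiv> 1 (mod p)\<close>, so a suitable digit \<open>j\<close> corrects the error modulo \<open>p\<^sup>n\<^sup>+\<^sup>e\<^sup>+\<^sup>1\<close>.
\<close>

lemma topological_generator:
  fixes u :: "'p::prime_card padic_int"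
  assumes e: "1 \<le> e" "CARD('p) \<noteq> 2 \<or> 2 \<le> e" and u: "padic_cong e u 1"
  obtains b where "u = padic_power (1 + \<p> ^ e) b"
proof -
  define g :: "'p padic_int" where "g = 1 + \<p> ^ e"
  have "padic_cong e g 1"
    by (simp add: g_def padic_cong_def)
  then have g: "padic_cong 1 g 1"
    using e(1) by (rule padic_cong_mono)
  have step: "\<exists>m'. padic_cong (Suc n + e) (g ^ m') u \<and> (\<exists>j. m' = m + CARD('p) ^ n * j)"
    if m: "padic_cong (n + e) (g ^ m) u" for n m
  proof -
    obtain c :: "'p padic_int" where c: "g ^ (CARD('p) ^ n) = 1 + \<p> ^ (n + e) * c" "padic_cong 1 c 1"
      using generator_power_p_power[OF e] unfolding g_def by blast
    \<comment> \<open>The digit \<open>j\<close> to append is the leading digit of the current error.\<close>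
    obtain d where d: "u - g ^ m = \<p> ^ (n + e) * d"
      using padic_cong_sym[OF m] by (auto simp: padic_cong_def)
    obtain j where j: "padic_cong 1 (of_nat j) d"
      using padic_nat_approximation by blast
    have "padic_cong (2 * (n + e)) ((1 + \<p> ^ (n + e) * c) ^ j) (1 + of_nat j * (\<p> ^ (n + e) * c))"
      by (rule padic_cong_power_one_plus)
    then have "padic_cong (Suc n + e) (g ^ m * (1 + \<p> ^ (n + e) * c) ^ j) (g ^ m * (1 + of_nat j * (\<p> ^ (n + e) * c)))"
      using e(1) by (intro padic_cong_mult padic_cong_refl) (auto elim: padic_cong_mono)
    then have "padic_cong (Suc n + e) (g ^ (m + CARD('p) ^ n * j)) (g ^ m + \<p> ^ (n + e) * (g ^ m * of_nat j * c))"
      by (simp only: power_add power_mult c(1)) (simp add: algebra_simps)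
    also have "padic_cong (Suc n + e) (g ^ m + \<p> ^ (n + e) * (g ^ m * of_nat j * c)) (g ^ m + \<p> ^ (n + e) * d)"
    proof (intro padic_cong_add padic_cong_refl)
      have "padic_cong 1 (g ^ m * of_nat j * c) (1 ^ m * d * 1)"
        by (intro padic_cong_mult padic_cong_power g j c)
      then have "padic_cong (n + e + 1) (\<p> ^ (n + e) * (g ^ m * of_nat j * c)) (\<p> ^ (n + e) * d)"
        unfolding padic_cong_p_power_mult_iff by simp
      then show "padic_cong (Suc n + e) (\<p> ^ (n + e) * (g ^ m * of_nat j * c)) (\<p> ^ (n + e) * d)"
        by (simp add: One_nat_def)
    qed
    also have "g ^ m + \<p> ^ (n + e) * d = u"
      by (simp flip: d)
    finally show ?thesis by blast
  qed
  have start: "\<exists>m. padic_cong (0 + e) (g ^ m) u"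
    using padic_cong_sym[OF u] by (intro exI[of _ 0]) simp
  obtain X where X: "\<And>n. padic_cong (n + e) (g ^ X n) u" "\<And>n. \<exists>j. X (Suc n) = X n + CARD('p) ^ n * j"
    using dependent_nat_choice[of "\<lambda>n m. padic_cong (n + e) (g ^ m) u"
        "\<lambda>n m m'. \<exists>j. m' = m + CARD('p) ^ n * j", OF start step] by blast
  have "padic_cong n (of_nat (X (Suc n))) (of_nat (X n) :: 'p padic_int)" for n
    using X(2)[of n] by (auto simp: padic_cong_def)
  then obtain b where b: "\<And>n. padic_cong n (of_nat (X n)) (b :: 'p padic_int)"
    using padic_complete[of "\<lambda>n. of_nat (X n)"] by blast
  have "u = padic_power g b"
  proof (rule padic_cong_imp_eq)
    fix n
    have "padic_cong n (g ^ X n) (padic_power g b)"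
      using padic_cong_padic_power[OF g b] by (rule padic_cong_mono) simp
    moreover have "padic_cong n (g ^ X n) u"
      using X(1)[of n] by (rule padic_cong_mono) simp
    ultimately show "padic_cong n u (padic_power g b)"
      using padic_cong_sym padic_cong_trans by blast
  qed
  then show thesis
    unfolding g_def by (rule that)
qed

section \<open>The group of roots of unity\<close>

lemma root_of_unity_power_cong:
  fixes \<theta> :: "'p::prime_card padic_int"
  assumes "\<theta> ^ N = 1" "[m = n] (mod N)"
  shows "\<theta> ^ m = \<theta> ^ n"
proof -
  obtain k l where "m + k * N = n + l * N"
    using assms(2) unfolding cong_iff_lin_nat by metis
  moreover have "\<theta> ^ (m + k * N) = \<theta> ^ m" for m k
    using assms(1) by (simp add: power_add power_mult mult.commute[of k])
  ultimately show ?thesis by metis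
qed

lemma root_of_unity_power:
  fixes \<theta> :: "'p::prime_card padic_int"
  assumes "\<theta> ^ N = 1"
  shows "(\<theta> ^ m) ^ N = 1"
proof -
  have "(\<theta> ^ m) ^ N = (\<theta> ^ N) ^ m"
    by (simp add: mult.commute flip: power_mult)
  then show ?thesis by (simp add: assms)
qed

text \<open>
  The Teichmueller lift of a primitive root modulo \<open>p\<close>: roots of unity are determined by their
  residues modulo \<open>p\<close>, so the group is a copy of the multiplicative group modulo \<open>p\<close>.
\<close>

lemma root_of_unity_generator:
  obtains \<zeta> :: "'p::prime_card padic_int"
  where "\<zeta> ^ (CARD('p) - 1) = 1"
    "\<And>\<theta>. \<theta> ^ (CARD('p) - 1) = 1 \<Longrightarrow> \<exists>i. \<theta> = \<zeta> ^ i"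
    "\<And>m. \<zeta> ^ m = 1 \<Longrightarrow> CARD('p) - 1 dvd m"
proof -
  let ?q = "CARD('p)"
  have prime: "prime ?q" by (rule prime_card)
  obtain g where g: "residue_primroot ?q g"
    using prime_primitive_root_exists[OF prime_gt_1_nat prime] prime by blast
  then have ord: "coprime ?q g" "ord ?q g = ?q - 1"
    using prime by (auto simp: residue_primroot_def totient_prime)
  have "\<not> ?q dvd g"
    using ord(1) prime by (metis coprime_absorb_left not_prime_unit)
  then have "\<not> padic_cong 1 (of_nat g :: 'p padic_int) (of_nat 0)"
    by (simp only: padic_cong_of_nat cong_0_iff power_one_right not_False_eq_True)
  then obtain \<zeta> :: "'p padic_int" where \<zeta>: "\<zeta> ^ (?q - 1) = 1" "padic_cong 1 (of_nat g) \<zeta>"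
    using teichmueller_exists by auto
  have \<zeta>_power: "padic_cong 1 (of_nat (g ^ i)) (\<zeta> ^ i)" for i
    using padic_cong_power[OF \<zeta>(2)] by simp
  show thesis
  proof
    show "\<zeta> ^ (?q - 1) = 1" by (rule \<zeta>)
  next
    fix \<theta> :: "'p padic_int"
    assume \<theta>: "\<theta> ^ (?q - 1) = 1"
    obtain m where m: "padic_cong 1 (of_nat m) \<theta>"
      using padic_nat_approximation by blast
    have "\<not> padic_cong 1 (of_nat m :: 'p padic_int) (of_nat 0)"
      using root_of_unity_unit[OF \<theta>] padic_cong_trans[OF padic_cong_sym[OF m]] by auto
    then have "\<not> ?q dvd m"
      by (simp only: padic_cong_of_nat cong_0_iff power_one_right not_False_eq_True)
    then have "m mod ?q \<in> totatives ?q"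
      using prime prime_imp_coprime[OF prime, of m]
      by (auto simp: totatives_def mod_eq_0_iff_dvd coprime_commute intro: gr0I)
    then obtain i where "m mod ?q = g ^ i mod ?q"
      using residue_primroot_is_generator[OF prime_gt_1_nat[OF prime] g] by (auto simp: bij_betw_def)
    then have "[m = g ^ i] (mod ?q)"
      by (simp add: cong_def)
    then have "padic_cong 1 (of_nat m) (of_nat (g ^ i) :: 'p padic_int)"
      by (simp only: padic_cong_of_nat power_one_right)
    then have "padic_cong 1 \<theta> (\<zeta> ^ i)"
      using m \<zeta>_power padic_cong_sym padic_cong_trans by blast
    moreover have "(\<zeta> ^ i) ^ (?q - 1) = 1"
      using \<zeta>(1) by (rule root_of_unity_power)
    ultimately have "\<theta> = \<zeta> ^ i"
      by (intro teichmueller_unique[OF \<theta>])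
    then show "\<exists>i. \<theta> = \<zeta> ^ i" ..
  next
    fix m assume "\<zeta> ^ m = 1"
    then have "padic_cong 1 (of_nat (g ^ m)) (of_nat 1 :: 'p padic_int)"
      using \<zeta>_power[of m] by simp
    then have "[g ^ m = 1] (mod ?q)"
      by (simp only: padic_cong_of_nat power_one_right)
    then show "?q - 1 dvd m"
      using ord(2) by (simp add: ord_divides)
  qed
qed

section \<open>Automorphisms of the additive system\<close>

text \<open>
  An automorphism induces a surjection, hence a permutation, of the finitely many residues modulo
  \<open>p\<^sup>k\<close>.
\<close>

lemma automorphism_cong_iff:
  assumes "padic_automorphism star f"
  shows "padic_cong k (f x) (f y) \<longleftrightarrow> padic_cong k x y"
proof -
  have cong: "padic_cong k (f x) (f y)" if "padic_cong k x y" for x y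
    using assms that by (cases k) (auto simp: padic_automorphism_def)
  have "surj f"
    using assms by (simp add: padic_automorphism_def bij_is_surj)
  then show ?thesis
    using padic_cong_reflect[of f k x y] cong by blast
qed

lemma additive_automorphism_iff:
  "padic_automorphism (+) f \<longleftrightarrow> (\<exists>A. \<not> padic_cong 1 A 0 \<and> (\<forall>x. f x = A * x))"
proof
  assume f: "padic_automorphism (+) f"
  then have add: "f (x + y) = f x + f y" for x y
    by (simp add: padic_automorphism_def)
  have f0: "f 0 = 0"
    by (metis add add_0_right add_left_cancel)
  have nat: "f (of_nat m) = f 1 * of_nat m" for m
    by (induction m) (simp_all add: f0 add algebra_simps)
  have "f x = f 1 * x" for x
  proof (rule padic_cong_imp_eq)
    fix n
    obtain m where m: "padic_cong n (of_nat m) x"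
      using padic_nat_approximation by blast
    have "padic_cong n (f (of_nat m)) (f x)"
      using m by (simp add: automorphism_cong_iff[OF f])
    moreover have "padic_cong n (f (of_nat m)) (f 1 * x)"
      unfolding nat by (intro padic_cong_mult padic_cong_refl m)
    ultimately show "padic_cong n (f x) (f 1 * x)"
      using padic_cong_sym padic_cong_trans by blast
  qed
  moreover have "\<not> padic_cong 1 (f 1) 0"
    using automorphism_cong_iff[OF f, of 1 1 0] by (simp add: f0)
  ultimately show "\<exists>A. \<not> padic_cong 1 A 0 \<and> (\<forall>x. f x = A * x)"
    by blast
next
  assume "\<exists>A. \<not> padic_cong 1 A 0 \<and> (\<forall>x. f x = A * x)"
  then obtain A where A: "\<not> padic_cong 1 A 0" and f: "f = (*) A"
    by auto
  obtain B where "A * B = 1"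
    using padic_unit[OF A] .
  then have "A * (B * x) = x" for x
    by (simp flip: mult.assoc)
  then have "bij f"
    unfolding f by (intro o_bij[of "(*) B"]) (simp_all add: fun_eq_iff mult.left_commute[of B A])
  then show "padic_automorphism (+) f"
    by (auto simp: padic_automorphism_def f distrib_left intro: padic_cong_mult)
qed

section \<open>Automorphisms of the multiplicative system\<close>

lemma p_power_dvd_unit_mult_iff:
  fixes y :: "'p::prime_card padic_int"
  assumes y: "\<not> padic_cong 1 y 0"
  shows "\<p> ^ m dvd \<p> ^ k * y \<longleftrightarrow> m \<le> k"
proof
  assume dvd: "\<p> ^ m dvd \<p> ^ k * y"
  show "m \<le> k"
  proof (rule ccontr)
    assume "\<not> m \<le> k"
    then have "m = k + (m - k)" "1 \<le> m - k" by auto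
    then have "padic_cong (k + (m - k)) (\<p> ^ k * y) (\<p> ^ k * 0)"
      using dvd by (simp add: padic_cong_0_right)
    then have "padic_cong (m - k) y 0"
      by (simp only: padic_cong_p_power_mult_iff)
    then show False
      using y padic_cong_mono \<open>1 \<le> m - k\<close> by blast
  qed
qed (simp add: le_imp_power_dvd dvd_mult2)

lemma padic_cong_unit_mult_iff:
  fixes x y z :: "'p::prime_card padic_int"
  assumes "\<not> padic_cong 1 z 0"
  shows "padic_cong n (z * x) (z * y) \<longleftrightarrow> padic_cong n x y"
proof
  obtain w where w: "z * w = 1"
    using padic_unit[OF assms] .
  assume "padic_cong n (z * x) (z * y)"
  then have "padic_cong n (w * (z * x)) (w * (z * y))"
    by (rule padic_cong_mult[OF padic_cong_refl])
  moreover have "w * (z * v) = v" for v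
    using w by (metis mult.assoc mult.commute mult.left_neutral)
  ultimately show "padic_cong n x y" by simp
qed (rule padic_cong_mult[OF padic_cong_refl])

lemma principal_unit_unit: "padic_cong 1 u 1 \<Longrightarrow> \<not> padic_cong 1 u (0 :: 'p::prime_card padic_int)"
  using not_padic_cong_1_0 padic_cong_sym padic_cong_trans by blast

text \<open>
  Modulo \<open>p\<close> the two units are \<open>\<theta>\<close> and \<open>\<eta>\<close>, so these agree by uniqueness and can be cancelled.
  The case of large \<open>n\<close> shows that the Teichmueller representation is unique.
\<close>

lemma unit_decomposition_cong:
  fixes \<theta> \<eta> u v :: "'p::prime_card padic_int"
  assumes roots: "\<theta> ^ (CARD('p) - 1) = 1" "\<eta> ^ (CARD('p) - 1) = 1"
    and u: "padic_cong 1 u 1" and v: "padic_cong 1 v 1"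
    and n: "1 \<le> n" and cong: "padic_cong n (\<theta> * u) (\<eta> * v)"
  shows "\<theta> = \<eta> \<and> padic_cong n u v"
proof -
  have "padic_cong 1 (\<theta> * 1) (\<theta> * u)" "padic_cong 1 (\<eta> * v) (\<eta> * 1)"
    by (rule padic_cong_mult[OF padic_cong_refl padic_cong_sym[OF u]],
        rule padic_cong_mult[OF padic_cong_refl v])
  moreover have "padic_cong 1 (\<theta> * u) (\<eta> * v)"
    using cong n by (rule padic_cong_mono)
  ultimately have "padic_cong 1 (\<theta> * 1) (\<eta> * 1)"
    using padic_cong_trans by blast
  then have "\<theta> = \<eta>"
    by (intro teichmueller_unique[OF roots]) simp
  moreover have "padic_cong n u v"
    using cong padic_cong_unit_mult_iff[OF root_of_unity_unit[OF roots(1)]] \<open>\<theta> = \<eta>\<close> by blast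
  ultimately show ?thesis ..
qed

lemma teichmueller_power_map_automorphism:
  fixes f :: "'p::prime_card padic_int \<Rightarrow> 'p padic_int"
  assumes A: "\<not> padic_cong 1 A 0" and a: "\<not> padic_cong 1 a 0" and s: "coprime s (CARD('p) - 1)"
    and f0: "f 0 = 0"
    and f: "\<And>k \<theta> u. \<theta> ^ (CARD('p) - 1) = 1 \<Longrightarrow> padic_cong 1 u 1 \<Longrightarrow>
      f (\<p> ^ k * \<theta> * u) = \<p> ^ k * A ^ k * \<theta> ^ s * padic_power u a"
  shows "padic_automorphism (*) f"
proof -
  let ?root = "\<lambda>\<theta> :: 'p padic_int. \<theta> ^ (CARD('p) - 1) = 1"
  let ?principal = "\<lambda>u :: 'p padic_int. padic_cong 1 u 1"
  have root_power: "?root (\<theta> ^ m)" if "?root \<theta>" for \<theta> m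
    using that by (rule root_of_unity_power)
  have unit: "\<not> padic_cong 1 (\<theta> * u) 0" if "?root \<theta>" "?principal u" for \<theta> u
    using that by (simp add: nonunit_mult_iff root_of_unity_unit principal_unit_unit)
  have A_power: "\<not> padic_cong 1 (A ^ k) 0" for k
    using A nonunit_power by blast
  have image_unit: "\<not> padic_cong 1 (A ^ k * (\<theta> ^ s * padic_power u a)) 0"
    if "?root \<theta>" "?principal u" for k \<theta> u
    using that A_power unit[OF root_power padic_power_cong_1] by (auto simp: nonunit_mult_iff[of "A ^ k"])
  have f': "f (\<p> ^ k * (\<theta> * u)) = \<p> ^ k * (A ^ k * (\<theta> ^ s * padic_power u a))"
    if "?root \<theta>" "?principal u" for k \<theta> u
    using f[OF that] by (simp add: mult.assoc)
  have rep: "\<exists>k \<theta> u. ?root \<theta> \<and> ?principal u \<and> x = \<p> ^ k * (\<theta> * u)" if "x \<noteq> 0" for x :: "'p padic_int"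
    using teichmueller_representation[OF that] by (metis mult.assoc)
  \<comment> \<open>The inverses of the parameters describe the inverse map.\<close>
  obtain r where r: "[s * r = 1] (mod (CARD('p) - 1))"
    using cong_solve_coprime_nat[OF s] by (auto simp: One_nat_def)
  have root_sr: "\<theta> ^ (s * r) = \<theta>" if "?root \<theta>" for \<theta>
    using root_of_unity_power_cong[OF that r] by simp
  obtain b where b: "a * b = 1"
    using padic_unit[OF a] .
  have power_ab: "padic_power (padic_power u a) b = u" "padic_power (padic_power u b) a = u" if "?principal u" for u
    using that padic_power_of_nat[OF that, of 1] b by (simp_all add: padic_power_power mult.commute)

  have mult: "f (x * y) = f x * f y" for x y
  proof (cases "x = 0 \<or> y = 0")
    case True
    then show ?thesis by (auto simp: f0)
  next
    case False
    then obtain k \<theta> u l \<eta> v where x: "?root \<theta>" "?principal u" "x = \<p> ^ k * (\<theta> * u)"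
      and y: "?root \<eta>" "?principal v" "y = \<p> ^ l * (\<eta> * v)"
      using rep by meson
    have xy: "x * y = \<p> ^ (k + l) * ((\<theta> * \<eta>) * (u * v))"
      by (simp add: x y power_add mult_ac)
    have "?root (\<theta> * \<eta>)" "?principal (u * v)"
      using x y padic_cong_mult[OF x(2) y(2)] by (simp_all add: power_mult_distrib)
    then have "f (x * y) = \<p> ^ (k + l) * (A ^ (k + l) * ((\<theta> * \<eta>) ^ s * padic_power (u * v) a))"
      unfolding xy by (rule f')
    moreover have "f x = \<p> ^ k * (A ^ k * (\<theta> ^ s * padic_power u a))"
      unfolding x(3) by (rule f'[OF x(1,2)])
    moreover have "f y = \<p> ^ l * (A ^ l * (\<eta> ^ s * padic_power v a))"
      unfolding y(3) by (rule f'[OF y(1,2)])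
    ultimately show ?thesis
      by (simp add: padic_power_mult_base[OF x(2) y(2)] power_add power_mult_distrib mult_ac)
  qed

  have dvd: "\<p> ^ n dvd f x" if "\<p> ^ n dvd x" for n x
  proof (cases "x = 0")
    case False
    then obtain k \<theta> u where x: "?root \<theta>" "?principal u" "x = \<p> ^ k * (\<theta> * u)"
      using rep by blast
    then have "n \<le> k"
      using that by (simp add: p_power_dvd_unit_mult_iff unit)
    then show ?thesis
      using x by (simp add: f' le_imp_power_dvd dvd_mult2)
  qed (simp add: f0)

  have cong: "padic_cong n (f x) (f y)" if xy: "padic_cong n x y" for n x y
  proof (cases "\<p> ^ n dvd x")
    case True
    then have "\<p> ^ n dvd y"
      using padic_cong_p_power_dvd_iff[OF xy order_refl] by blast
    with True dvd show ?thesis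
      by (simp add: padic_cong_def)
  next
    case False
    then have "\<not> \<p> ^ n dvd y"
      using padic_cong_p_power_dvd_iff[OF xy order_refl] by blast
    with False obtain k \<theta> u l \<eta> v where x: "?root \<theta>" "?principal u" "x = \<p> ^ k * (\<theta> * u)"
      and y: "?root \<eta>" "?principal v" "y = \<p> ^ l * (\<eta> * v)"
      using rep by (metis dvd_0_right)
    have less: "k < n" "l < n"
      using False \<open>\<not> \<p> ^ n dvd y\<close> by (auto simp: x y p_power_dvd_unit_mult_iff unit)
    have "m \<le> k \<longleftrightarrow> m \<le> l" if "m \<le> n" for m
      using padic_cong_p_power_dvd_iff[OF xy that] unfolding x(3) y(3)
      by (simp add: p_power_dvd_unit_mult_iff unit x(1,2) y(1,2))
    then have "k = l"
      using less by (meson le_antisym less_imp_le order_refl)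
    have n: "n = k + (n - k)" "1 \<le> n - k"
      using less by auto
    have "padic_cong (k + (n - k)) (\<p> ^ k * (\<theta> * u)) (\<p> ^ k * (\<eta> * v))"
      using xy less by (simp add: x(3) y(3) \<open>k = l\<close>)
    then have "padic_cong (n - k) (\<theta> * u) (\<eta> * v)"
      by (simp only: padic_cong_p_power_mult_iff)
    then have eq: "\<theta> = \<eta>" "padic_cong (n - k) u v"
      using unit_decomposition_cong[OF x(1) y(1) x(2) y(2) n(2)] by auto
    \<comment> \<open>Congruence modulo \<open>p\<^sup>n\<close> of \<open>x\<close> and \<open>y\<close> only controls the units modulo \<open>p\<^sup>n\<^sup>-\<^sup>k\<close>, but the factor \<open>p\<^sup>k\<close> restores the precision.\<close>
    have "padic_cong (k + (n - k)) (\<p> ^ k * (A ^ k * (\<theta> ^ s * padic_power u a))) (\<p> ^ k * (A ^ k * (\<theta> ^ s * padic_power v a)))"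
      unfolding padic_cong_p_power_mult_iff
      by (intro padic_cong_mult padic_cong_refl padic_power_cong x(2) y(2) eq(2))
    then show ?thesis
      using n(1) by (simp add: x y f' eq \<open>k = l\<close>)
  qed

  have nonzero: "f x \<noteq> 0" if "x \<noteq> 0" for x
  proof -
    obtain k \<theta> u where x: "?root \<theta>" "?principal u" "x = \<p> ^ k * (\<theta> * u)"
      using rep[OF \<open>x \<noteq> 0\<close>] by blast
    have "A ^ k * (\<theta> ^ s * padic_power u a) \<noteq> 0"
      using image_unit[OF x(1,2), of k] padic_cong_refl by metis
    then show ?thesis
      unfolding x(3) f'[OF x(1,2)] by simp
  qed

  have "inj f"
  proof (rule injI)
    fix x y assume fxy: "f x = f y"
    show "x = y"
    proof (cases "x = 0 \<or> y = 0")
      case True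
      then show ?thesis using fxy nonzero f0 by metis
    next
      case False
      then obtain k \<theta> u l \<eta> v where x: "?root \<theta>" "?principal u" "x = \<p> ^ k * (\<theta> * u)"
        and y: "?root \<eta>" "?principal v" "y = \<p> ^ l * (\<eta> * v)"
        using rep by meson
      have eq: "\<p> ^ k * (A ^ k * (\<theta> ^ s * padic_power u a)) = \<p> ^ l * (A ^ l * (\<eta> ^ s * padic_power v a))"
        using fxy x y by (simp add: f')
      have "m \<le> k \<longleftrightarrow> m \<le> l" for m
        using p_power_dvd_unit_mult_iff[OF image_unit[OF x(1,2)], of m k k]
          p_power_dvd_unit_mult_iff[OF image_unit[OF y(1,2)], of m l l] by (simp only: eq)
      then have "k = l"
        by (meson le_antisym order_refl)
      moreover have "A \<noteq> 0"
        using A by auto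
      ultimately have "\<theta> ^ s * padic_power u a = \<eta> ^ s * padic_power v a"
        using eq by simp
      then have eq': "\<theta> ^ s = \<eta> ^ s" "padic_cong n (padic_power u a) (padic_power v a)" if "1 \<le> n" for n
        using unit_decomposition_cong[OF root_power[OF x(1), of s] root_power[OF y(1), of s]
            padic_power_cong_1[OF x(2), of a] padic_power_cong_1[OF y(2), of a] that]
        by simp_all
      have "\<theta> = \<eta>"
        using eq'(1)[OF order_refl] root_sr[OF x(1)] root_sr[OF y(1)] by (simp add: power_mult)
      moreover have "padic_power u a = padic_power v a"
      proof (rule padic_cong_imp_eq)
        show "padic_cong n (padic_power u a) (padic_power v a)" for n
          by (rule padic_cong_mono[OF eq'(2)[of "Suc n"]]) (simp_all add: One_nat_def)
      qed
      then have "u = v"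
        using power_ab(1) x(2) y(2) by metis
      ultimately show ?thesis
        by (simp add: x y \<open>k = l\<close>)
    qed
  qed

  moreover have "surj f"
  proof (rule surjI)
    fix y :: "'p padic_int"
    have "\<exists>x. f x = y"
    proof (cases "y = 0")
      case False
      then obtain k \<eta> v where y: "?root \<eta>" "?principal v" "y = \<p> ^ k * (\<eta> * v)"
        using rep by blast
      \<comment> \<open>A preimage must absorb \<open>A\<^sup>k\<close>, so \<open>A\<^sup>-\<^sup>k\<close> times the unit part of \<open>y\<close> is decomposed anew.\<close>
      obtain B where B: "A ^ k * B = 1"
        using padic_unit[OF A_power] .
      have "\<not> padic_cong 1 B 0"
        using nonunit_mult_iff[of "A ^ k" B] by (simp add: B)
      then have "\<not> padic_cong 1 (B * (\<eta> * v)) 0"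
        using unit[OF y(1,2)] by (simp add: nonunit_mult_iff[of B])
      then obtain \<theta> u where u: "?root \<theta>" "?principal u" "B * (\<eta> * v) = \<theta> * u"
        by (rule unit_decomposition)
      have "f (\<p> ^ k * (\<theta> ^ r * padic_power u b)) = \<p> ^ k * (A ^ k * ((\<theta> ^ r) ^ s * u))"
        using f'[OF root_power[OF u(1)] padic_power_cong_1[OF u(2)]] by (simp only: power_ab(2)[OF u(2)])
      also have "(\<theta> ^ r) ^ s = \<theta> ^ (s * r)"
        by (simp add: mult.commute flip: power_mult)
      also have "\<p> ^ k * (A ^ k * (\<theta> ^ (s * r) * u)) = \<p> ^ k * (A ^ k * B * (\<eta> * v))"
        by (simp only: root_sr[OF u(1)] u(3)[symmetric] mult.assoc)
      also have "\<dots> = y"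
        by (simp add: B y)
      finally show ?thesis ..
    qed (use f0 in blast)
    then show "f (SOME x. f x = y) = y"
      by (rule someI_ex)
  qed
  ultimately show ?thesis
    using mult cong by (simp add: padic_automorphism_def bij_def)
qed

lemma multiplicative_automorphism_0:
  fixes f :: "'p::prime_card padic_int \<Rightarrow> 'p padic_int"
  assumes f: "padic_automorphism (*) f"
  shows "f 0 = 0"
proof -
  obtain y where "f y = 0"
    using f by (metis bij_is_surj padic_automorphism_def surjD)
  moreover have "f (0 * y) = f 0 * f y"
    using f unfolding padic_automorphism_def by blast
  ultimately show ?thesis by simp
qed

lemma multiplicative_automorphism_power:
  fixes f :: "'p::prime_card padic_int \<Rightarrow> 'p padic_int"
  assumes f: "padic_automorphism (*) f"
  shows "f (x ^ m) = f x ^ m"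
proof (induction m)
  case 0
  have "f 1 * f 1 = f 1 * 1"
    using f unfolding padic_automorphism_def by (metis mult.right_neutral)
  moreover have "f 1 \<noteq> f 0"
    using f by (simp add: padic_automorphism_def bij_is_inj inj_eq)
  ultimately show ?case
    by (simp add: multiplicative_automorphism_0[OF f])
next
  case (Suc m)
  then show ?case
    using f by (simp add: padic_automorphism_def)
qed

text \<open>
  On the subgroup topologically generated by \<open>g = 1 + p\<^sup>e\<close>, continuity makes \<open>f\<close> the power with the
  exponent \<open>a\<close> given by \<open>f(g) = g\<^sup>a\<close>.  This subgroup consists of the units that are \<open>1\<close> modulo \<open>p\<^sup>e\<close>,
  which for \<open>p = 2\<close>, where \<open>e = 2\<close>, leaves out the units \<open>u \<equiv> 3 (mod 4)\<close>; these are reached through the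
  factor \<open>-1\<close>.
\<close>

lemma multiplicative_automorphism_principal_units:
  fixes f :: "'p::prime_card padic_int \<Rightarrow> 'p padic_int"
  assumes f: "padic_automorphism (*) f"
  obtains a where "\<not> padic_cong 1 a 0" "\<And>u. padic_cong 1 u 1 \<Longrightarrow> f u = padic_power u a"
proof -
  have mult: "f (x * y) = f x * f y" for x y
    using f by (simp add: padic_automorphism_def)
  have cong: "padic_cong k (f x) (f y) \<longleftrightarrow> padic_cong k x y" for k x y
    using automorphism_cong_iff[OF f] .
  have f1: "f 1 = 1" and power: "f (x ^ m) = f x ^ m" for x m
    using multiplicative_automorphism_0[OF f] multiplicative_automorphism_power[OF f, of x 0]
      multiplicative_automorphism_power[OF f] by simp_all
  define e :: nat where "e = (if CARD('p) = 2 then 2 else 1)"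
  have e: "1 \<le> e" "CARD('p) \<noteq> 2 \<or> 2 \<le> e"
    by (auto simp: e_def)
  define g :: "'p padic_int" where "g = 1 + \<p> ^ e"
  have g: "padic_cong e g 1"
    by (simp add: g_def padic_cong_def)
  then have g1: "padic_cong 1 g 1"
    using e(1) by (rule padic_cong_mono)
  have "padic_cong e (f g) 1"
    using g cong[of e g 1] by (simp add: f1)
  then obtain a where a: "f g = padic_power g a"
    using topological_generator[OF e] unfolding g_def by blast
  have a_unit: "\<not> padic_cong 1 a 0"
  proof
    assume "padic_cong 1 a 0"
    then obtain b where b: "a = of_nat CARD('p) * b"
      by (auto simp: padic_cong_0_right)
    \<comment> \<open>If \<open>a = p b\<close>, then \<open>f(g) = (g\<^sup>p)\<^sup>b\<close> is closer to \<open>1 = f(1)\<close> than \<open>g\<close> is to \<open>1\<close>.\<close>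
    have gp: "padic_cong (Suc e) (g ^ CARD('p)) 1"
      using padic_cong_power_p[OF g e(1)] by simp
    then have gp1: "padic_cong 1 (g ^ CARD('p)) 1"
      by (rule padic_cong_mono) (simp add: One_nat_def)
    have "f g = padic_power (g ^ CARD('p)) b"
      using padic_power_power[OF g1, of "of_nat CARD('p)" b] by (simp add: a b padic_power_of_nat[OF g1])
    moreover have "padic_cong (Suc e) (padic_power (g ^ CARD('p)) b) (padic_power 1 b)"
      using gp gp1 by (intro padic_power_cong) auto
    moreover have "padic_power 1 b = 1"
      by (rule padic_power_eqI) auto
    ultimately have "padic_cong (Suc e) g 1"
      using cong[of "Suc e" g 1] by (simp add: f1)
    then have "\<p> ^ Suc e dvd (\<p> ^ e * 1 :: 'p padic_int)"
      by (simp add: padic_cong_def g_def)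
    then show False
      by (subst (asm) p_power_dvd_unit_mult_iff) auto
  qed
  have generated: "f u = padic_power u a" if u: "padic_cong e u 1" for u
  proof -
    obtain b where b: "u = padic_power g b"
      using topological_generator[OF e u] unfolding g_def .
    have fg1: "padic_cong 1 (f g) 1"
      unfolding a by (rule padic_power_cong_1[OF g1])
    have "f u = padic_power (f g) b"
    proof (rule padic_power_eqI[OF fg1, symmetric])
      fix n m assume m: "padic_cong n (of_nat m) b"
      have "padic_cong n (g ^ m) u"
        unfolding b using padic_cong_padic_power[OF g1 m] by (rule padic_cong_mono) simp
      then show "padic_cong n (f g ^ m) (f u)"
        by (simp add: cong flip: power)
    qed
    then show ?thesis
      by (simp add: a b padic_power_power[OF g1] mult.commute)
  qed
  have "f u = padic_power u a" if u: "padic_cong 1 u 1" for u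
  proof (cases "CARD('p) = 2")
    case False
    then show ?thesis
      using u by (intro generated) (simp add: e_def)
  next
    case True
    have p: "\<p> = (2 :: 'p padic_int)"
      by (simp add: True)
    have minus_1: "padic_cong 1 (- 1) (1 :: 'p padic_int)"
      by (simp add: padic_cong_def p)
    have "f (- 1) * f (- 1) = 1"
      using mult[of "- 1" "- 1"] by (simp add: f1)
    then have "f (- 1) = 1 \<or> f (- 1) = - 1"
      by (simp add: square_eq_1_iff)
    moreover have "f (- 1) \<noteq> 1"
    proof
      assume "f (- 1) = 1"
      then have "f (- 1) = f 1"
        by (simp add: f1)
      then have "- 1 = (1 :: 'p padic_int)"
        using f by (simp add: padic_automorphism_def bij_is_inj inj_eq)
      then have "(2 :: 'p padic_int) = 0"
        by (metis add.right_inverse one_add_one)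
      then show False
        using p_nonzero[where 'p = 'p] unfolding p by contradiction
    qed
    ultimately have f_minus_1: "f (- 1) = - 1"
      by blast
    have power_minus_1: "padic_power (- 1) a = - 1"
    proof (rule padic_power_eqI[OF minus_1])
      fix n m assume m: "padic_cong n (of_nat m) a"
      show "padic_cong n ((- 1) ^ m) (- 1)"
      proof (cases "n = 0")
        case False
        then have "padic_cong 1 (of_nat m) a"
          by (intro padic_cong_mono[OF m]) simp
        then have "\<not> padic_cong 1 (of_nat m :: 'p padic_int) (of_nat 0)"
          using a_unit padic_cong_sym padic_cong_trans by fastforce
        then have "odd m"
          by (simp only: padic_cong_of_nat cong_0_iff True power_one_right not_False_eq_True)
        then show ?thesis by simp
      qed simp
    qed
    obtain t where "u - 1 = 2 * t"
      using u by (auto simp: padic_cong_def p)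
    then have t: "u = 1 + 2 * t"
      by (simp add: algebra_simps)
    obtain m where m: "padic_cong 1 (of_nat m) t"
      using padic_nat_approximation by blast
    have parity: "padic_cong 1 (of_nat i) (0 :: 'p padic_int)" if "even i" for i
      using that by (auto simp: padic_cong_def p elim!: dvdE)
    show ?thesis
    proof (cases "even m")
      case True
      then have "padic_cong 1 t 0"
        by (rule padic_cong_trans[OF padic_cong_sym[OF m] parity])
      then have "padic_cong e u 1"
        using \<open>CARD('p) = 2\<close> by (auto simp: padic_cong_def p t e_def power2_eq_square)
      then show ?thesis by (rule generated)
    next
      case False
      have "padic_cong 1 (t + 1) (of_nat m + of_nat 1)"
        using padic_cong_add[OF padic_cong_sym[OF m] padic_cong_refl] by simp
      also have "of_nat m + of_nat 1 = (of_nat (m + 1) :: 'p padic_int)"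
        by (rule of_nat_add[symmetric])
      also have "padic_cong 1 (of_nat (m + 1)) (0 :: 'p padic_int)"
        using False by (intro parity) simp
      finally have "padic_cong 1 (t + 1) 0" .
      then obtain d where "t + 1 = 2 * d"
        by (auto simp: padic_cong_def p)
      then have "t = 2 * d - 1"
        by (simp add: eq_diff_eq)
      have "- u - 1 = 2 ^ 2 * (- d)"
        unfolding t \<open>t = 2 * d - 1\<close> by (simp add: algebra_simps power2_eq_square)
      then have e_minus_u: "padic_cong e (- u) 1"
        using \<open>CARD('p) = 2\<close> by (simp add: padic_cong_def p e_def)
      have "f u = f (- 1) * f (- u)"
        using mult[of "- 1" "- u"] by simp
      also have "\<dots> = padic_power (- 1) a * padic_power (- u) a"
        by (simp only: f_minus_1 power_minus_1 generated[OF e_minus_u])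
      also have "\<dots> = padic_power (- 1 * - u) a"
        using padic_cong_mono[OF e_minus_u e(1)] by (intro padic_power_mult_base[symmetric] minus_1)
      finally show ?thesis by simp
    qed
  qed
  with a_unit show thesis by (rule that)
qed

text \<open>
  The exponent \<open>s\<close> is read off from a generator \<open>\<zeta>\<close>.  If \<open>d = gcd(s, p - 1)\<close>, then \<open>f\<close> maps
  \<open>\<zeta>\<close> to the power \<open>(p - 1)/d\<close> to \<open>1\<close>, so injectivity forces \<open>d = 1\<close>.
\<close>

lemma multiplicative_automorphism_roots_of_unity:
  fixes f :: "'p::prime_card padic_int \<Rightarrow> 'p padic_int"
  assumes f: "padic_automorphism (*) f"
  obtains s where "s \<in> {1..CARD('p) - 1}" "coprime s (CARD('p) - 1)"
    "\<And>\<theta>. \<theta> ^ (CARD('p) - 1) = 1 \<Longrightarrow> f \<theta> = \<theta> ^ s"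
proof -
  let ?N = "CARD('p) - 1"
  have N: "1 \<le> ?N"
    using p_gt_1[where 'p = 'p] by simp
  note power = multiplicative_automorphism_power[OF f]
  have f1: "f 1 = 1"
    using power[of 1 0] by simp
  obtain \<zeta> :: "'p padic_int" where \<zeta>: "\<zeta> ^ ?N = 1"
    "\<And>\<theta>. \<theta> ^ ?N = 1 \<Longrightarrow> \<exists>i. \<theta> = \<zeta> ^ i" "\<And>m. \<zeta> ^ m = 1 \<Longrightarrow> ?N dvd m"
    by (rule root_of_unity_generator) blast
  have "f \<zeta> ^ ?N = 1"
    using power[of \<zeta> ?N] by (simp add: \<zeta>(1) f1)
  then obtain i where i: "f \<zeta> = \<zeta> ^ i"
    using \<zeta>(2) by blast
  \<comment> \<open>The representative of \<open>i\<close> modulo \<open>p - 1\<close> in \<open>{1..p - 1}\<close> rather than in \<open>{0..<p - 1}\<close>.\<close>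
  define s where "s = (if i mod ?N = 0 then ?N else i mod ?N)"
  have "s \<in> {1..?N}"
    using N by (auto simp: s_def intro: less_imp_le mod_less_divisor)
  have "[i = s] (mod ?N)"
    by (simp add: s_def cong_def)
  then have s: "f \<zeta> = \<zeta> ^ s"
    unfolding i by (rule root_of_unity_power_cong[OF \<zeta>(1)])
  have "coprime s ?N"
  proof -
    define d where "d = gcd s ?N"
    have "d dvd ?N" "d dvd s"
      unfolding d_def by (rule gcd_dvd2, rule gcd_dvd1)
    then obtain M s' where M: "?N = d * M" and s': "s = d * s'"
      unfolding dvd_def by blast
    have "f (\<zeta> ^ M) = \<zeta> ^ (s * M)"
      by (simp add: power s power_mult)
    also have "s * M = ?N * s'"
      by (simp add: M s')
    also have "\<zeta> ^ (?N * s') = f 1"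
      by (simp add: power_mult \<zeta>(1) f1)
    finally have "\<zeta> ^ M = 1"
      using f by (simp add: padic_automorphism_def bij_is_inj inj_eq)
    then have "d * M dvd M"
      using \<zeta>(3) by (simp flip: M)
    moreover have "M \<noteq> 0"
      using M N by (intro notI) simp
    ultimately have "d = 1"
      by (simp add: dvd_mult_cancel2)
    then show ?thesis
      by (simp add: d_def coprime_iff_gcd_eq_1)
  qed
  moreover have "f \<theta> = \<theta> ^ s" if \<theta>: "\<theta> ^ ?N = 1" for \<theta>
  proof -
    obtain j where "\<theta> = \<zeta> ^ j"
      using \<zeta>(2)[OF \<theta>] by blast
    then show ?thesis
      by (simp add: power s mult.commute flip: power_mult)
  qed
  ultimately show thesis
    using \<open>s \<in> {1..?N}\<close> by (intro that)
qed

lemma multiplicative_automorphism_p: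
  fixes f :: "'p::prime_card padic_int \<Rightarrow> 'p padic_int"
  assumes f: "padic_automorphism (*) f"
  obtains A where "f \<p> = \<p> * A" "\<not> padic_cong 1 A 0"
proof -
  have cong: "padic_cong k (f \<p>) 0 \<longleftrightarrow> padic_cong k (\<p> :: 'p padic_int) 0" for k
    using automorphism_cong_iff[OF f, of k \<p> 0] by (simp add: multiplicative_automorphism_0[OF f])
  have "\<p> dvd f \<p>"
    using cong[of 1] by (simp add: padic_cong_0_right)
  then obtain A where A: "f \<p> = \<p> * A" ..
  have "\<not> padic_cong 1 A 0"
  proof
    assume "padic_cong 1 A 0"
    then have "\<p> ^ 2 dvd f \<p>"
      by (simp add: A padic_cong_0_right power2_eq_square mult_dvd_mono)
    then have "\<p> ^ 2 dvd \<p> ^ 1 * (1 :: 'p padic_int)"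
      using cong[of 2] by (simp add: padic_cong_0_right)
    then show False
      by (subst (asm) p_power_dvd_unit_mult_iff) auto
  qed
  with A show thesis by (rule that)
qed

lemma multiplicative_automorphism_iff:
  fixes f :: "'p::prime_card padic_int \<Rightarrow> 'p padic_int"
  shows "padic_automorphism (*) f \<longleftrightarrow>
    (\<exists>a A. \<exists>s\<in>{1..CARD('p) - 1}.
      \<not> padic_cong 1 A 0 \<and> \<not> padic_cong 1 a 0 \<and> gcd s (CARD('p) - 1) = 1 \<and> f 0 = 0 \<and>
      (\<forall>k \<theta> t. \<theta> ^ (CARD('p) - 1) = 1 \<longrightarrow>
        f (\<p> ^ k * \<theta> * (1 + \<p> * t)) = \<p> ^ k * A ^ k * \<theta> ^ s * padic_power (1 + \<p> * t) a))"
    (is "_ \<longleftrightarrow> (\<exists>a A. \<exists>s\<in>_. ?form a A s)")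
proof
  assume f: "padic_automorphism (*) f"
  then have mult: "f (x * y) = f x * f y" for x y
    by (simp add: padic_automorphism_def)
  obtain A where A: "f \<p> = \<p> * A" "\<not> padic_cong 1 A 0"
    using multiplicative_automorphism_p[OF f] .
  obtain s where s: "s \<in> {1..CARD('p) - 1}" "coprime s (CARD('p) - 1)"
    "\<And>\<theta>. \<theta> ^ (CARD('p) - 1) = 1 \<Longrightarrow> f \<theta> = \<theta> ^ s"
    using multiplicative_automorphism_roots_of_unity[OF f] by blast
  obtain a where a: "\<not> padic_cong 1 a 0" "\<And>u. padic_cong 1 u 1 \<Longrightarrow> f u = padic_power u a"
    using multiplicative_automorphism_principal_units[OF f] by blast
  have formula: "f (\<p> ^ k * \<theta> * (1 + \<p> * t)) = \<p> ^ k * A ^ k * \<theta> ^ s * padic_power (1 + \<p> * t) a"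
    if "\<theta> ^ (CARD('p) - 1) = 1" for k \<theta> t
  proof -
    have "padic_cong 1 (1 + \<p> * t) 1"
      by (simp add: padic_cong_def)
    then show ?thesis
      using that by (simp only: mult multiplicative_automorphism_power[OF f] A(1) s(3) a(2) power_mult_distrib)
  qed
  have "gcd s (CARD('p) - 1) = 1"
    using s(2) by (simp only: coprime_iff_gcd_eq_1)
  then have "?form a A s"
    by (intro conjI allI impI A(2) a(1) multiplicative_automorphism_0[OF f] formula)
  then show "\<exists>a A. \<exists>s\<in>{1..CARD('p) - 1}. ?form a A s"
    by (intro exI bexI[OF _ s(1)])
next
  assume "\<exists>a A. \<exists>s\<in>{1..CARD('p) - 1}. ?form a A s"
  then obtain a where "\<exists>A. \<exists>s\<in>{1..CARD('p) - 1}. ?form a A s" ..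
  then obtain A where "\<exists>s\<in>{1..CARD('p) - 1}. ?form a A s" ..
  then obtain s where form: "?form a A s" ..
  show "padic_automorphism (*) f"
  proof (rule teichmueller_power_map_automorphism[of A a s])
    fix k and \<theta> u :: "'p padic_int"
    assume \<theta>: "\<theta> ^ (CARD('p) - 1) = 1" and "padic_cong 1 u 1"
    then obtain t where "u - 1 = \<p> * t"
      by (auto simp: padic_cong_def)
    then have "u = 1 + \<p> * t"
      by (simp add: algebra_simps)
    with form \<theta> show "f (\<p> ^ k * \<theta> * u) = \<p> ^ k * A ^ k * \<theta> ^ s * padic_power u a"
      by blast
  qed (use form in \<open>auto simp: coprime_iff_gcd_eq_1\<close>)
qed

theorem theorem2p1:
  shows
    "carrier (padic_Aut ((+) :: 'p::prime_card padic_int \<Rightarrow> 'p padic_int \<Rightarrow> 'p padic_int)) =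
       {f. \<exists>A. \<not> padic_cong 1 A 0 \<and> (\<forall>x. f x = A * x)} \<and>
     carrier (padic_Aut ((*) :: 'p padic_int \<Rightarrow> 'p padic_int \<Rightarrow> 'p padic_int)) =
       {f. \<exists>a A. \<exists>s\<in>{1..CARD('p) - 1}.
          \<not> padic_cong 1 A 0 \<and> \<not> padic_cong 1 a 0 \<and> gcd s (CARD('p) - 1) = 1 \<and>
          f 0 = 0 \<and>
          (\<forall>k \<theta> t. \<theta> ^ (CARD('p) - 1) = 1 \<longrightarrow>
             f (\<p> ^ k * \<theta> * (1 + \<p> * t)) = \<p> ^ k * A ^ k * \<theta> ^ s * padic_power (1 + \<p> * t) a)}"
  by (simp only: padic_Aut_def partial_object.simps additive_automorphism_iff multiplicative_automorphism_iff)

end
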